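(* Let $r\ge2$ be an integer, and let $F$ be a finite $r$-graph with $e(F)>0$ and no isolated vertices. Suppose that a family is $F$-abundant with constants $c,C>0$. (1) If the family consists of $F$-coloured $r$-graphs, then it contains an $F$-abundant member $(H,\sigma)$ satisfying $v(H^\circ)\le\lfloor 2r(C+1)\rfloor$. (2) If the family consists of $r$-graphs, then it contains an $F$-abundant member $H$ satisfying $v(H^\circ)\le\lfloor 2r(C+1)\rfloor$.
   Context: An $r$-graph is a finite simple $r$-uniform hypergraph $H$ with vertex set $V(H)$ and edge set $E(H)$; $v(H)=|V(H)|$, $e(H)=|E(H)|$. A vertex is isolated if it lies in no edge. $H^\circ$ denotes the $r$-graph obtained from $H$ by deleting all isolated vertices. A homomorphism $H\to G$ is a map $\phi:V(H)\to V(G)$ with $\phi(e)\in E(G)$ for every $e\in E(H)$; an embedding is an injective homomorphism. $\mathrm{Emb}(H,G)$ is the number of embeddings of $H$ into $G$. Copies are not required to be induced; $G$ is $F$-free if there is no embedding of $F$ into $G$. An $n$-vertex $r$-graph $G$ is $\varepsilon$-far from being $F$-free if at least $\varepsilon n^r$ edges must be deleted from $G$ to make it $F$-free. An $F$-colouring of an $r$-graph $G$ is a homomorphism $\kappa_G:G\to F$; the sets $V_a(G)=\kappa_G^{-1}(a)$, $a\in V(F)$, form an $F$-partition of $G$, and an $r$-graph with such a (fixed) partition is called $F$-partite. An $F$-coloured $r$-graph is a pair $(H,\sigma)$ with $\sigma:H\to F$ an $F$-colouring. For $G$ $F$-partite, $\mathrm{Emb}_\sigma(H,G)$ is the number of embeddings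 $\phi:H\to G$ with $\kappa_G\circ\phi=\sigma$. An $n$-vertex $F$-partite $r$-graph $G$ is uniformly $\varepsilon$-far from being $F$-free if there is a collection $\mathcal C$ of embeddings $\psi:F\to G$ such that the sets $\psi(E(F))$, $\psi\in\mathcal C$, are pairwise disjoint, $\kappa_G\circ\psi=\mathrm{id}_{V(F)}$ for every $\psi\in\mathcal C$, and every vertex of $G$ belongs to $\psi(V(F))$ for at least $\varepsilon n^{r-1}$ members $\psi\in\mathcal C$. Abundance. - An $r$-graph $H$ is $F$-abundant if there are constants $c',C'>0$ such that, for every $0<\varepsilon\le1$, there is $n_0(\varepsilon)$ for which every $\varepsilon$-far $n$-vertex $r$-graph $G$ with $n\ge n_0(\varepsilon)$ satisfies $\mathrm{Emb}(H,G)\ge c'\varepsilon^{C'} n^{v(H)}$. - An $F$-coloured $r$-graph $(H,\sigma)$ is $F$-abundant if there are constants $c',C'>0$ such that, for every $0<\varepsilon\le1$, there is $n_0(\varepsilon)$ for which every uniformly $\varepsilon$-far $n$-vertex $F$-partite $r$-graph $G$ with $n\ge n_0(\varepsilon)$ satisfies $\mathrm{Emb}_\sigma(H,G)\ge c'\varepsilon^{C'} n^{v(H)}$. - A (possibly infinite) family $\mathcal U$ of $r$-graphs is $F$-abundant with constants $c,C>0$ if, for every $0<\varepsilon\le1$, there is $n_0(\varepsilon)$ for which every $\varepsilon$-far $n$-vertex $r$-graph $G$ with $n\ge n_0(\varepsilon)$ admits some $H\in\mathcal U$ (which may depend on $G$ and $\varepsilon$) with $\mathrm{Emb}(H,G)\ge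 c\varepsilon^C n^{v(H)}$. - A (possibly infinite) family $\mathcal H$ of $F$-coloured $r$-graphs is $F$-abundant with constants $c,C>0$ if, for every $0<\varepsilon\le1$, there is $n_0(\varepsilon)$ for which every uniformly $\varepsilon$-far $n$-vertex $F$-partite $r$-graph $G$ with $n\ge n_0(\varepsilon)$ admits some $(H,\sigma)\in\mathcal H$ (which may depend on $G$ and $\varepsilon$) with $\mathrm{Emb}_\sigma(H,G)\ge c\varepsilon^C n^{v(H)}$. *)

theory Defs
  imports Complex_Main "HOL-Library.FuncSet"
begin

record 'a hgraph =
  verts :: "'a set"
  edges :: "'a set set"

abbreviation nverts :: "'a hgraph \<Rightarrow> nat" where
  "nverts H \<equiv> card (verts H)"

abbreviation nedges :: "'a hgraph \<Rightarrow> nat" where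
  "nedges H \<equiv> card (edges H)"

definition rgraph :: "nat \<Rightarrow> 'a hgraph \<Rightarrow> bool" where
  "rgraph r H \<longleftrightarrow> finite (verts H) \<and> (\<forall>e\<in>edges H. e \<subseteq> verts H \<and> card e = r)"

definition isolated :: "'a hgraph \<Rightarrow> 'a \<Rightarrow> bool" where
  "isolated H x \<longleftrightarrow> x \<in> verts H \<and> (\<forall>e\<in>edges H. x \<notin> e)"

definition del_isolated :: "'a hgraph \<Rightarrow> 'a hgraph" where
  "del_isolated H = \<lparr>verts = {x \<in> verts H. \<not> isolated H x}, edges = edges H\<rparr>"

definition homomorphism :: "'a hgraph \<Rightarrow> 'b hgraph \<Rightarrow> ('a \<Rightarrow> 'b) \<Rightarrow> bool" where
  "homomorphism H G \<phi> \<longleftrightarrow> \<phi> \<in> verts H \<rightarrow> verts G \<and> (\<forall>e\<in>edges H. \<phi> ` e \<in> edges G)"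

definition embedding :: "'a hgraph \<Rightarrow> 'b hgraph \<Rightarrow> ('a \<Rightarrow> 'b) \<Rightarrow> bool" where
  "embedding H G \<phi> \<longleftrightarrow> homomorphism H G \<phi> \<and> inj_on \<phi> (verts H)"

text \<open>Maps defined on \<open>verts H\<close> only are represented by functions extensional on
  \<open>verts H\<close>, so that embeddings are counted and collected without repetition.\<close>

definition Embs :: "'a hgraph \<Rightarrow> 'b hgraph \<Rightarrow> ('a \<Rightarrow> 'b) set" where
  "Embs H G = {\<phi> \<in> extensional (verts H). embedding H G \<phi>}"

definition Emb :: "'a hgraph \<Rightarrow> 'b hgraph \<Rightarrow> nat" where
  "Emb H G = card (Embs H G)"

definition free_of :: "'a hgraph \<Rightarrow> 'b hgraph \<Rightarrow> bool" where
  "free_of F G \<longleftrightarrow> (\<nexists>\<phi>. embedding F G \<phi>)"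

definition del_edges :: "'a hgraph \<Rightarrow> 'a set set \<Rightarrow> 'a hgraph" where
  "del_edges G D = \<lparr>verts = verts G, edges = edges G - D\<rparr>"

definition far :: "nat \<Rightarrow> 'f hgraph \<Rightarrow> real \<Rightarrow> 'b hgraph \<Rightarrow> bool" where
  "far r F \<epsilon> G \<longleftrightarrow>
     (\<forall>D \<subseteq> edges G. free_of F (del_edges G D) \<longrightarrow> real (card D) \<ge> \<epsilon> * real (nverts G) ^ r)"

text \<open>A pair \<open>(H, \<sigma>)\<close> encodes both an \<open>F\<close>-coloured and an \<open>F\<close>-partite \<open>r\<close>-graph;
  only the values of \<open>\<sigma>\<close> on \<open>verts H\<close> matter.\<close>

definition coloured :: "nat \<Rightarrow> 'f hgraph \<Rightarrow> 'a hgraph \<times> ('a \<Rightarrow> 'f) \<Rightarrow> bool" where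
  "coloured r F = (\<lambda>(H, \<sigma>). rgraph r H \<and> homomorphism H F \<sigma>)"

definition Emb_col ::
    "'a hgraph \<times> ('a \<Rightarrow> 'f) \<Rightarrow> 'b hgraph \<times> ('b \<Rightarrow> 'f) \<Rightarrow> nat" where
  "Emb_col = (\<lambda>(H, \<sigma>) (G, \<kappa>). card {\<phi> \<in> Embs H G. \<forall>x\<in>verts H. \<kappa> (\<phi> x) = \<sigma> x})"

definition uniformly_far ::
    "nat \<Rightarrow> 'f hgraph \<Rightarrow> real \<Rightarrow> 'b hgraph \<times> ('b \<Rightarrow> 'f) \<Rightarrow> bool" where
  "uniformly_far r F \<epsilon> = (\<lambda>(G, \<kappa>).
     \<exists>\<C> \<subseteq> Embs F G.
       (\<forall>\<psi>\<in>\<C>. \<forall>\<psi>'\<in>\<C>. \<psi> \<noteq> \<psi>' \<longrightarrow> ((`) \<psi> ` edges F) \<inter> ((`) \<psi>' ` edges F) = {}) \<and>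
       (\<forall>\<psi>\<in>\<C>. \<forall>a\<in>verts F. \<kappa> (\<psi> a) = a) \<and>
       (\<forall>x\<in>verts G. real (card {\<psi> \<in> \<C>. x \<in> \<psi> ` verts F}) \<ge> \<epsilon> * real (nverts G) ^ (r - 1)))"

text \<open>In the abundance notions the host graph \<open>G\<close> ranges over all finite \<open>r\<close>-graphs with
  vertices in \<^typ>\<open>nat\<close>; every finite \<open>r\<close>-graph is isomorphic to one of these.\<close>

definition abundant :: "nat \<Rightarrow> 'f hgraph \<Rightarrow> 'a hgraph \<Rightarrow> bool" where
  "abundant r F H \<longleftrightarrow>
     (\<exists>c'>0. \<exists>C'>0. \<forall>\<epsilon>::real. 0 < \<epsilon> \<and> \<epsilon> \<le> 1 \<longrightarrow>
        (\<exists>n\<^sub>0::nat. \<forall>G::nat hgraph. rgraph r G \<and> nverts G \<ge> n\<^sub>0 \<and> far r F \<epsilon> G \<longrightarrow>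
           real (Emb H G) \<ge> c' * \<epsilon> powr C' * real (nverts G) ^ nverts H))"

definition abundant_col :: "nat \<Rightarrow> 'f hgraph \<Rightarrow> 'a hgraph \<times> ('a \<Rightarrow> 'f) \<Rightarrow> bool" where
  "abundant_col r F = (\<lambda>(H, \<sigma>).
     \<exists>c'>0. \<exists>C'>0. \<forall>\<epsilon>::real. 0 < \<epsilon> \<and> \<epsilon> \<le> 1 \<longrightarrow>
        (\<exists>n\<^sub>0::nat. \<forall>(G::nat hgraph) \<kappa>.
           coloured r F (G, \<kappa>) \<and> nverts G \<ge> n\<^sub>0 \<and> uniformly_far r F \<epsilon> (G, \<kappa>) \<longrightarrow>
           real (Emb_col (H, \<sigma>) (G, \<kappa>)) \<ge> c' * \<epsilon> powr C' * real (nverts G) ^ nverts H))"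

definition abundant_family ::
    "nat \<Rightarrow> 'f hgraph \<Rightarrow> real \<Rightarrow> real \<Rightarrow> 'a hgraph set \<Rightarrow> bool" where
  "abundant_family r F c C \<U> \<longleftrightarrow>
     (\<forall>\<epsilon>::real. 0 < \<epsilon> \<and> \<epsilon> \<le> 1 \<longrightarrow>
        (\<exists>n\<^sub>0::nat. \<forall>G::nat hgraph. rgraph r G \<and> nverts G \<ge> n\<^sub>0 \<and> far r F \<epsilon> G \<longrightarrow>
           (\<exists>H\<in>\<U>. real (Emb H G) \<ge> c * \<epsilon> powr C * real (nverts G) ^ nverts H)))"

definition abundant_family_col ::
    "nat \<Rightarrow> 'f hgraph \<Rightarrow> real \<Rightarrow> real \<Rightarrow> ('a hgraph \<times> ('a \<Rightarrow> 'f)) set \<Rightarrow> bool" where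
  "abundant_family_col r F c C \<H> \<longleftrightarrow>
     (\<forall>\<epsilon>::real. 0 < \<epsilon> \<and> \<epsilon> \<le> 1 \<longrightarrow>
        (\<exists>n\<^sub>0::nat. \<forall>(G::nat hgraph) \<kappa>.
           coloured r F (G, \<kappa>) \<and> nverts G \<ge> n\<^sub>0 \<and> uniformly_far r F \<epsilon> (G, \<kappa>) \<longrightarrow>
           (\<exists>(H, \<sigma>)\<in>\<H>. real (Emb_col (H, \<sigma>) (G, \<kappa>))
                            \<ge> c * \<epsilon> powr C * real (nverts G) ^ nverts H)))"

end

theory Submission
  imports Defs
    "HOL-Computational_Algebra.Polynomial"
    "HOL-Computational_Algebra.Primes"
    "HOL-Number_Theory.Cong"
    "HOL-Library.Nat_Bijection"
begin

text \<open>Write \<open>t\<close> for the density of homomorphisms that respect the colouring: the number of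
colour-preserving homomorphisms \<open>H \<rightarrow> G\<close> divided by the number of all colour-preserving maps.
It dominates the densities of embeddings: \<open>Emb\<^sub>\<sigma>(H,G) \<le> t n\<^sup>v\<close>, and since the colour-preserving
maps for the different \<open>\<sigma>\<close> partition all maps, also \<open>Emb(H,G) \<le> \<delta> n\<^sup>v\<close> as soon as \<open>t \<le> \<delta>\<close> for
every \<open>\<sigma>\<close>, whatever the size of \<open>H\<close> (lemma \<open>Emb_le_hom_density\<close>). Hence a family cannot be abundant
once there are uniformly far hosts \<open>G\<close>, arbitrarily large for one fixed parameter \<open>\<epsilon>\<close>, in which
\<open>t < c \<epsilon>\<^sup>C\<close> holds at once for all members, with all their colourings in the uncoloured case. The theorem is proved by building
such hosts under the assumption that no member of the family is both abundant and small
(lemma \<open>sparse_host\<close>).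

The tool is the fibre product over \<open>F\<close>: it multiplies the densities \<open>t\<close> and it multiplies
the parameters of uniform farness (lemmas \<open>hom_density_fprod\<close> and \<open>uniform_host_fprod\<close>). Three
kinds of factors are used.

\<^item> If \<open>(H,\<sigma>)\<close> is not abundant, then for every exponent \<open>K\<close> some uniformly \<open>\<epsilon>\<close>-far host has
  \<open>t \<le> \<epsilon>\<^sup>K\<close>. Products of suitable powers achieve this for finitely many coloured graphs at once,
  because powers of two hosts can be chosen so that their parameters are polynomially comparable.
  Since \<open>t\<close> ignores isolated vertices, the members with \<open>v(H\<degree>) \<le> 2r(C+1)\<close> fall into finitely many types.

\<^item> If \<open>v(H\<degree>) > rN\<close> for the integer \<open>N = \<lfloor>2(C+1)\<rfloor>\<close>, then one can pick \<open>N+1\<close> edges each of which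
  has a vertex outside the earlier ones. In a host in which the last vertex of an edge is
  determined by the other \<open>r-1\<close>, this costs a factor \<open>1/m\<close> per edge, where \<open>m\<close> is the size of the
  parts. The evaluation vectors of polynomials of degree less than \<open>r-1\<close> over the field with \<open>m\<close>
  elements give such a host that is uniformly \<open>m\<^sup>-\<^sup>2\<close>-far, so \<open>t \<le> \<epsilon>\<^sup>C\<^sup>+\<^sup>1\<close> there. The square lost in
  the parameter is the reason for the factor \<open>2\<close> in the bound \<open>2r(C+1)\<close>.

\<^item> Polynomials of degree less than \<open>r\<close> give arbitrarily large hosts whose parameter depends on \<open>F\<close>
  only. One more product with such a host makes the number of vertices large.

For families of uncoloured graphs, a uniformly far host is also far as an uncoloured graph,
and if \<open>H\<close> is not abundant then no colouring of \<open>H\<close> is: a far graph contains a large uniformly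
far subgraph with respect to a suitable partition (lemma \<open>far_imp_uniformly_far_subgraph\<close>).\<close>

section \<open>Partite homomorphism densities\<close>

definition part :: "'b hgraph \<Rightarrow> ('b \<Rightarrow> 'f) \<Rightarrow> 'f \<Rightarrow> 'b set" where
  "part G \<kappa> a = {y \<in> verts G. \<kappa> y = a}"

definition Homs_col :: "'a hgraph \<Rightarrow> ('a \<Rightarrow> 'f) \<Rightarrow> 'b hgraph \<Rightarrow> ('b \<Rightarrow> 'f) \<Rightarrow> ('a \<Rightarrow> 'b) set" where
  "Homs_col H \<sigma> G \<kappa> =
     {\<phi> \<in> (\<Pi>\<^sub>E x\<in>verts H. part G \<kappa> (\<sigma> x)). \<forall>e\<in>edges H. \<phi> ` e \<in> edges G}"

text \<open>Normalising by the sizes of the parts instead of by powers of the number of vertices makes this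
density exactly multiplicative under fibre products and blind to isolated vertices.\<close>

definition hom_density :: "'a hgraph \<Rightarrow> ('a \<Rightarrow> 'f) \<Rightarrow> 'b hgraph \<Rightarrow> ('b \<Rightarrow> 'f) \<Rightarrow> real" where
  "hom_density H \<sigma> G \<kappa> =
     real (card (Homs_col H \<sigma> G \<kappa>)) / (\<Prod>x\<in>verts H. real (card (part G \<kappa> (\<sigma> x))))"

lemma finite_part [simp]: "finite (verts G) \<Longrightarrow> finite (part G \<kappa> a)"
  by (simp add: part_def)

lemma card_part_le: "finite (verts G) \<Longrightarrow> card (part G \<kappa> a) \<le> nverts G"
  by (auto simp: part_def intro: card_mono)

lemma finite_edges: "rgraph r H \<Longrightarrow> finite (edges H)"
  by (rule finite_subset[of _ "Pow (verts H)"]) (auto simp: rgraph_def)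

lemma finite_verts: "rgraph r H \<Longrightarrow> finite (verts H)"
  by (simp add: rgraph_def)

lemma finite_Embs:
  assumes "finite (verts H)" "finite (verts G)"
  shows "finite (Embs H G)"
proof (rule finite_subset)
  show "Embs H G \<subseteq> verts H \<rightarrow>\<^sub>E verts G"
    by (auto simp: Embs_def embedding_def homomorphism_def PiE_def)
qed (use assms in \<open>auto intro: finite_PiE\<close>)

lemma finite_Homs_col:
  assumes "finite (verts H)" "finite (verts G)"
  shows "finite (Homs_col H \<sigma> G \<kappa>)"
  unfolding Homs_col_def using assms by (intro finite_Collect_conjI disjI1) (auto intro!: finite_PiE)

lemma hom_density_nonneg: "0 \<le> hom_density H \<sigma> G \<kappa>"
  by (auto simp: hom_density_def intro!: divide_nonneg_nonneg prod_nonneg)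

lemma card_Homs_col_le:
  assumes "finite (verts H)" "finite (verts G)"
  shows "card (Homs_col H \<sigma> G \<kappa>) \<le> (\<Prod>x\<in>verts H. card (part G \<kappa> (\<sigma> x)))"
proof -
  have "card (Homs_col H \<sigma> G \<kappa>) \<le> card (\<Pi>\<^sub>E x\<in>verts H. part G \<kappa> (\<sigma> x))"
    unfolding Homs_col_def using assms by (intro card_mono) (auto intro!: finite_PiE)
  thus ?thesis by (simp add: card_PiE assms)
qed

lemma card_Homs_col:
  assumes "finite (verts H)" "finite (verts G)"
  shows "real (card (Homs_col H \<sigma> G \<kappa>)) = hom_density H \<sigma> G \<kappa> * (\<Prod>x\<in>verts H. real (card (part G \<kappa> (\<sigma> x))))"
  using card_Homs_col_le[OF assms, of \<sigma> \<kappa>]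
  by (cases "(\<Prod>x\<in>verts H. card (part G \<kappa> (\<sigma> x))) = 0")
     (simp_all only: hom_density_def of_nat_prod[symmetric], simp_all del: of_nat_prod)

lemma hom_density_le_1:
  assumes "finite (verts H)" "finite (verts G)"
  shows "hom_density H \<sigma> G \<kappa> \<le> 1"
  using card_Homs_col_le[OF assms, of \<sigma> \<kappa>]
  by (auto simp: hom_density_def divide_le_eq_1 simp flip: of_nat_prod)

lemma Emb_col_le_hom_density:
  assumes "finite (verts H)" "finite (verts G)"
  shows "real (Emb_col (H, \<sigma>) (G, \<kappa>)) \<le> hom_density H \<sigma> G \<kappa> * real (nverts G) ^ nverts H"
proof -
  have "Emb_col (H, \<sigma>) (G, \<kappa>) \<le> card (Homs_col H \<sigma> G \<kappa>)"
    unfolding Emb_col_def prod.case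
    by (rule card_mono[OF finite_Homs_col[OF assms]])
       (auto simp: Embs_def embedding_def homomorphism_def Homs_col_def part_def PiE_def Pi_def)
  hence "real (Emb_col (H, \<sigma>) (G, \<kappa>)) \<le> hom_density H \<sigma> G \<kappa> * (\<Prod>x\<in>verts H. real (card (part G \<kappa> (\<sigma> x))))"
    by (simp flip: card_Homs_col[OF assms])
  also have "\<dots> \<le> hom_density H \<sigma> G \<kappa> * (\<Prod>x\<in>verts H. real (nverts G))"
    by (intro mult_left_mono prod_mono hom_density_nonneg) (auto simp: card_part_le assms)
  finally show ?thesis by simp
qed

text \<open>The number of colourings of \<open>H\<close> does not enter: the products of part sizes, summed over
all colourings, count the maps from the vertices of \<open>H\<close> to those of \<open>G\<close> exactly once.\<close>

lemma Emb_le_hom_density: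
  assumes H: "rgraph r H" and G: "coloured r F (G, \<kappa>)" and F: "finite (verts F)"
    and le: "\<And>\<sigma>. coloured r F (H, \<sigma>) \<Longrightarrow> hom_density H \<sigma> G \<kappa> \<le> \<delta>"
    and "0 \<le> \<delta>"
  shows "real (Emb H G) \<le> \<delta> * real (nverts G) ^ nverts H"
proof -
  have fin: "finite (verts H)" "finite (verts G)"
    using H G by (auto simp: coloured_def rgraph_def)
  define S where "S = verts H \<rightarrow>\<^sub>E verts F"
  have finS: "finite S" by (simp add: S_def finite_PiE fin F)
  have hom: "homomorphism G F \<kappa>" using G by (simp add: coloured_def)
  have sub: "Embs H G \<subseteq> (\<Union>\<sigma>\<in>S. Homs_col H \<sigma> G \<kappa>)"
  proof
    fix \<phi> assume \<phi>: "\<phi> \<in> Embs H G"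
    define \<sigma> where "\<sigma> = restrict (\<kappa> \<circ> \<phi>) (verts H)"
    have "\<sigma> \<in> S" "\<phi> \<in> Homs_col H \<sigma> G \<kappa>"
      using \<phi> hom by (auto simp: \<sigma>_def S_def Embs_def embedding_def homomorphism_def Homs_col_def part_def PiE_def Pi_def)
    thus "\<phi> \<in> (\<Union>\<sigma>\<in>S. Homs_col H \<sigma> G \<kappa>)" by blast
  qed
  have part: "real (card (Homs_col H \<sigma> G \<kappa>)) \<le> \<delta> * (\<Prod>x\<in>verts H. real (card (part G \<kappa> (\<sigma> x))))"
    if "\<sigma> \<in> S" for \<sigma>
  proof (cases "Homs_col H \<sigma> G \<kappa> = {}")
    case True
    thus ?thesis using \<open>0 \<le> \<delta>\<close> by (auto intro!: mult_nonneg_nonneg prod_nonneg)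
  next
    case False
    then obtain \<phi> where \<phi>: "\<phi> \<in> Homs_col H \<sigma> G \<kappa>" by blast
    have "\<sigma> ` e \<in> edges F" if "e \<in> edges H" for e
    proof -
      have "e \<subseteq> verts H" using that H by (auto simp: rgraph_def)
      hence "\<sigma> ` e = \<kappa> ` \<phi> ` e"
        using \<phi> unfolding image_image
        by (intro image_cong) (auto simp: Homs_col_def part_def PiE_def Pi_def subset_iff)
      thus ?thesis using \<phi> hom that by (auto simp: Homs_col_def homomorphism_def)
    qed
    hence "coloured r F (H, \<sigma>)" using that H
      by (auto simp: coloured_def homomorphism_def S_def)
    from le[OF this] show ?thesis
      unfolding card_Homs_col[OF fin] by (intro mult_right_mono prod_nonneg) auto
  qed
  have "real (Emb H G) \<le> real (card (\<Union>\<sigma>\<in>S. Homs_col H \<sigma> G \<kappa>))"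
    unfolding Emb_def using sub finS fin by (intro of_nat_mono card_mono) (auto simp: finite_Homs_col)
  also have "\<dots> \<le> (\<Sum>\<sigma>\<in>S. real (card (Homs_col H \<sigma> G \<kappa>)))"
    using card_UN_le[OF finS] by (simp flip: of_nat_sum)
  also have "\<dots> \<le> (\<Sum>\<sigma>\<in>S. \<delta> * (\<Prod>x\<in>verts H. real (card (part G \<kappa> (\<sigma> x)))))"
    by (intro sum_mono part)
  also have "\<dots> = \<delta> * (\<Prod>x\<in>verts H. \<Sum>a\<in>verts F. real (card (part G \<kappa> a)))"
    unfolding S_def using prod_sum_PiE[of "verts H" "\<lambda>_. verts F" "\<lambda>x a. real (card (part G \<kappa> a))"] fin F
    by (simp add: sum_distrib_left)
  also have "(\<Sum>a\<in>verts F. real (card (part G \<kappa> a))) = real (card (\<Union>a\<in>verts F. part G \<kappa> a))"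
    using F fin by (subst card_UN_disjoint) (auto simp: part_def)
  also have "(\<Union>a\<in>verts F. part G \<kappa> a) = verts G"
    using hom by (auto simp: part_def homomorphism_def)
  finally show ?thesis by simp
qed

text \<open>This reduces the densities of all small graphs to those of finitely many graphs on initial
segments of the natural numbers.\<close>

lemma hom_density_iso:
  assumes \<beta>: "bij_betw \<beta> (verts H) V" and sub: "\<And>e. e \<in> edges H \<Longrightarrow> e \<subseteq> verts H"
    and \<sigma>': "\<And>x. x \<in> verts H \<Longrightarrow> \<sigma>' (\<beta> x) = \<sigma> x"
  shows "hom_density \<lparr>verts = V, edges = (`) \<beta> ` edges H\<rparr> \<sigma>' G \<kappa> = hom_density H \<sigma> G \<kappa>"
proof -
  let ?H = "\<lparr>verts = V, edges = (`) \<beta> ` edges H\<rparr>"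
  define \<gamma> where "\<gamma> = inv_into (verts H) \<beta>"
  have \<gamma>: "\<gamma> (\<beta> x) = x" if "x \<in> verts H" for x
    using \<beta> that by (auto simp: \<gamma>_def bij_betw_def)
  have V: "V = \<beta> ` verts H" using \<beta> by (simp add: bij_betw_def)
  have inter: "e \<inter> verts H = e" "e \<inter> {x. x \<notin> verts H} = {}" if "e \<in> edges H" for e
    using sub[OF that] by auto
  have inter': "\<beta> ` e \<inter> \<beta> ` verts H = \<beta> ` e" "\<beta> ` e \<inter> {y. y \<notin> \<beta> ` verts H} = {}"
      "(\<lambda>y. \<phi> (\<gamma> y)) ` \<beta> ` e = \<phi> ` e" if "e \<in> edges H" for e and \<phi> :: "'a \<Rightarrow> 'd"
    using sub[OF that] by (auto simp: image_image \<gamma> subset_iff intro!: image_cong)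
  have "bij_betw (\<lambda>\<phi>. \<lambda>x\<in>verts H. \<phi> (\<beta> x)) (Homs_col ?H \<sigma>' G \<kappa>) (Homs_col H \<sigma> G \<kappa>)"
  proof (rule bij_betw_byWitness[where f' = "\<lambda>\<phi>. \<lambda>y\<in>V. \<phi> (\<gamma> y)"])
    show "\<forall>\<phi>\<in>Homs_col ?H \<sigma>' G \<kappa>. (\<lambda>y\<in>V. (\<lambda>x\<in>verts H. \<phi> (\<beta> x)) (\<gamma> y)) = \<phi>"
      by (auto simp: Homs_col_def V \<gamma> fun_eq_iff PiE_def extensional_def)
    show "\<forall>\<phi>\<in>Homs_col H \<sigma> G \<kappa>. (\<lambda>x\<in>verts H. (\<lambda>y\<in>V. \<phi> (\<gamma> y)) (\<beta> x)) = \<phi>"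
      by (auto simp: Homs_col_def V \<gamma> fun_eq_iff PiE_def extensional_def)
    show "(\<lambda>\<phi>. \<lambda>x\<in>verts H. \<phi> (\<beta> x)) ` Homs_col ?H \<sigma>' G \<kappa> \<subseteq> Homs_col H \<sigma> G \<kappa>"
      by (auto simp: Homs_col_def inter image_image) (auto simp: V PiE_def Pi_def \<sigma>')
    show "(\<lambda>\<phi>. \<lambda>y\<in>V. \<phi> (\<gamma> y)) ` Homs_col H \<sigma> G \<kappa> \<subseteq> Homs_col ?H \<sigma>' G \<kappa>"
      by (auto simp: Homs_col_def V inter') (auto simp: V PiE_def Pi_def \<sigma>' \<gamma>)
  qed
  hence "card (Homs_col ?H \<sigma>' G \<kappa>) = card (Homs_col H \<sigma> G \<kappa>)"
    by (rule bij_betw_same_card)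
  moreover have "(\<Prod>y\<in>V. real (card (part G \<kappa> (\<sigma>' y)))) = (\<Prod>x\<in>verts H. real (card (part G \<kappa> (\<sigma> x))))"
    using prod.reindex_bij_betw[OF \<beta>, of "\<lambda>y. real (card (part G \<kappa> (\<sigma>' y)))"] by (simp add: \<sigma>')
  ultimately show ?thesis by (simp add: hom_density_def)
qed

lemma verts_del_isolated:
  assumes "rgraph r H" shows "verts (del_isolated H) = \<Union>(edges H)"
  using assms by (auto simp: del_isolated_def isolated_def rgraph_def)

lemma edges_del_isolated [simp]: "edges (del_isolated H) = edges H"
  by (simp add: del_isolated_def)

text \<open>An isolated vertex contributes the same factor, the size of its part, to the numerator and to
the denominator. Nonempty parts exclude the quotient \<open>0 / 0\<close>.\<close>

lemma hom_density_del_isolated: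
  assumes H: "rgraph r H" and G: "finite (verts G)"
    and ne: "\<And>x. x \<in> verts H \<Longrightarrow> part G \<kappa> (\<sigma> x) \<noteq> {}"
  shows "hom_density (del_isolated H) \<sigma> G \<kappa> = hom_density H \<sigma> G \<kappa>"
proof -
  let ?A = "verts (del_isolated H)"
  define B where "B = verts H - ?A"
  let ?P = "\<lambda>x. part G \<kappa> (\<sigma> x)"
  have fin: "finite (verts H)" using H by (rule finite_verts)
  have A: "?A \<subseteq> verts H" by (auto simp: del_isolated_def)
  have sub: "e \<subseteq> ?A" if "e \<in> edges H" for e
    using that by (auto simp: verts_del_isolated[OF H])
  have finA: "finite ?A" "finite B" using A fin by (auto intro: finite_subset simp: B_def)
  have inter: "e \<inter> ?A = e" "e \<inter> {x. x \<notin> ?A} = {}" if "e \<in> edges H" for e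
    using sub[OF that] by auto
  have inter': "e \<inter> verts H = e" "e \<inter> {x. x \<notin> verts H} = {}" if "e \<in> edges H" for e
    using sub[OF that] A by auto
  have "bij_betw (\<lambda>\<phi>. (restrict \<phi> ?A, restrict \<phi> B)) (Homs_col H \<sigma> G \<kappa>)
          (Homs_col (del_isolated H) \<sigma> G \<kappa> \<times> Pi\<^sub>E B ?P)"
  proof (rule bij_betw_byWitness[where f' = "\<lambda>(f, g). \<lambda>x\<in>verts H. if x \<in> ?A then f x else g x"])
    show "\<forall>a\<in>Homs_col H \<sigma> G \<kappa>. (case (restrict a ?A, restrict a B) of
            (f, g) \<Rightarrow> \<lambda>x\<in>verts H. if x \<in> ?A then f x else g x) = a"
      by (auto simp: Homs_col_def B_def fun_eq_iff PiE_def extensional_def)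
    show "\<forall>a'\<in>Homs_col (del_isolated H) \<sigma> G \<kappa> \<times> Pi\<^sub>E B ?P.
       (restrict (case a' of (f, g) \<Rightarrow> \<lambda>x\<in>verts H. if x \<in> ?A then f x else g x) ?A,
        restrict (case a' of (f, g) \<Rightarrow> \<lambda>x\<in>verts H. if x \<in> ?A then f x else g x) B) = a'"
      using A by (auto simp: Homs_col_def B_def fun_eq_iff PiE_def extensional_def)
    show "(\<lambda>\<phi>. (restrict \<phi> ?A, restrict \<phi> B)) ` Homs_col H \<sigma> G \<kappa>
        \<subseteq> Homs_col (del_isolated H) \<sigma> G \<kappa> \<times> Pi\<^sub>E B ?P"
      using A by (auto simp: Homs_col_def inter B_def)
    show "(\<lambda>(f, g). \<lambda>x\<in>verts H. if x \<in> ?A then f x else g x) `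
          (Homs_col (del_isolated H) \<sigma> G \<kappa> \<times> Pi\<^sub>E B ?P) \<subseteq> Homs_col H \<sigma> G \<kappa>"
      using A by (auto simp: Homs_col_def inter inter') (auto simp: B_def)
  qed
  hence "card (Homs_col H \<sigma> G \<kappa>) = card (Homs_col (del_isolated H) \<sigma> G \<kappa> \<times> Pi\<^sub>E B ?P)"
    by (rule bij_betw_same_card)
  also have "\<dots> = card (Homs_col (del_isolated H) \<sigma> G \<kappa>) * (\<Prod>x\<in>B. card (?P x))"
    by (simp add: card_cartesian_product card_PiE finA)
  finally have card: "real (card (Homs_col H \<sigma> G \<kappa>)) =
     real (card (Homs_col (del_isolated H) \<sigma> G \<kappa>)) * (\<Prod>x\<in>B. real (card (?P x)))" by simp
  have "(\<Prod>x\<in>verts H. real (card (?P x))) = (\<Prod>x\<in>?A. real (card (?P x))) * (\<Prod>x\<in>B. real (card (?P x)))"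
    using prod.subset_diff[OF A fin] by (simp add: B_def mult.commute)
  moreover have "(\<Prod>x\<in>B. real (card (?P x))) \<noteq> 0"
    using ne finA G by (auto simp: B_def)
  ultimately show ?thesis by (simp add: hom_density_def card)
qed

text \<open>A map that identifies a given pair of points is determined by its values off one of them.\<close>

lemma card_noninjective_le:
  assumes "finite W" "finite V"
  shows "card {\<phi> \<in> W \<rightarrow>\<^sub>E V. \<not> inj_on \<phi> W} \<le> card W ^ 2 * card V ^ (card W - 1)"
proof -
  let ?D = "{p \<in> W \<times> W. fst p \<noteq> snd p}"
  let ?S = "\<lambda>p. {\<phi> \<in> W \<rightarrow>\<^sub>E V. \<phi> (fst p) = \<phi> (snd p)}"
  have fin: "finite ?D" using assms by simp
  have finS: "finite (?S p)" for p using assms by (auto intro!: finite_PiE)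
  have "{\<phi> \<in> W \<rightarrow>\<^sub>E V. \<not> inj_on \<phi> W} \<subseteq> (\<Union>p\<in>?D. ?S p)"
    by (auto simp: inj_on_def)
  hence "card {\<phi> \<in> W \<rightarrow>\<^sub>E V. \<not> inj_on \<phi> W} \<le> card (\<Union>p\<in>?D. ?S p)"
    using fin finS by (intro card_mono) auto
  also have "\<dots> \<le> (\<Sum>p\<in>?D. card (?S p))" by (rule card_UN_le[OF fin])
  also have "\<dots> \<le> (\<Sum>p\<in>?D. card V ^ (card W - 1))"
  proof (rule sum_mono)
    fix p assume p: "p \<in> ?D"
    have "card (?S p) \<le> card ((W - {fst p}) \<rightarrow>\<^sub>E V)"
    proof (rule card_inj_on_le)
      show "inj_on (\<lambda>\<phi>. restrict \<phi> (W - {fst p})) (?S p)"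
      proof (rule inj_onI)
        fix \<phi> \<theta> assume *: "\<phi> \<in> ?S p" "\<theta> \<in> ?S p" "restrict \<phi> (W - {fst p}) = restrict \<theta> (W - {fst p})"
        have eq: "\<phi> x = \<theta> x" if "x \<in> W" "x \<noteq> fst p" for x
          using fun_cong[OF *(3), of x] that by simp
        moreover have "\<phi> (fst p) = \<theta> (fst p)" using * p eq[of "snd p"] by auto
        ultimately have "\<phi> x = \<theta> x" if "x \<in> W" for x using that by metis
        thus "\<phi> = \<theta>" using * by (intro PiE_ext[of \<phi> W "\<lambda>_. V" \<theta>]) auto
      qed
    qed (use assms in \<open>auto intro!: finite_PiE split: if_splits\<close>)
    also have "\<dots> = card V ^ (card W - 1)" using assms p by (auto simp: card_PiE)
    finally show "card (?S p) \<le> card V ^ (card W - 1)" .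
  qed
  also have "\<dots> \<le> card W ^ 2 * card V ^ (card W - 1)"
  proof -
    have "card ?D \<le> card (W \<times> W)" using assms by (intro card_mono) auto
    thus ?thesis by (simp add: card_cartesian_product power2_eq_square)
  qed
  finally show ?thesis .
qed

text \<open>Passing from embeddings to homomorphisms costs a term of smaller order only, which is absorbed by
taking the host large.\<close>

lemma card_Homs_col_le_Emb_col:
  assumes "finite (verts H)" "finite (verts G)"
  shows "card (Homs_col H \<sigma> G \<kappa>) \<le> Emb_col (H, \<sigma>) (G, \<kappa>) + nverts H ^ 2 * nverts G ^ (nverts H - 1)"
proof -
  let ?E = "{\<phi> \<in> Embs H G. \<forall>x\<in>verts H. \<kappa> (\<phi> x) = \<sigma> x}"
  let ?N = "{\<phi> \<in> verts H \<rightarrow>\<^sub>E verts G. \<not> inj_on \<phi> (verts H)}"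
  have fin: "finite ?E" "finite ?N" using finite_Embs[OF assms] assms
    by (auto intro!: finite_PiE)
  have "Homs_col H \<sigma> G \<kappa> \<subseteq> ?E \<union> ?N"
    by (auto simp: Homs_col_def Embs_def embedding_def homomorphism_def part_def PiE_def Pi_def)
  hence "card (Homs_col H \<sigma> G \<kappa>) \<le> card (?E \<union> ?N)" using fin by (intro card_mono) auto
  also have "\<dots> \<le> card ?E + card ?N" by (rule card_Un_le)
  finally show ?thesis using card_noninjective_le[OF assms] by (simp add: Emb_col_def)
qed

section \<open>Fibre products over the pattern\<close>

abbreviation proj1 :: "nat \<Rightarrow> nat" where "proj1 z \<equiv> fst (prod_decode z)"
abbreviation proj2 :: "nat \<Rightarrow> nat" where "proj2 z \<equiv> snd (prod_decode z)"

text \<open>Vertices are pairs of vertices of the same colour, encoded as natural numbers so that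
products of hosts are again hosts with natural numbers as vertices. A set of pairs is an edge if
both projections are edges; that such a set has \<open>r\<close> elements follows from the colourings being
injective on edges.\<close>

definition fprod :: "nat hgraph \<Rightarrow> (nat \<Rightarrow> 'f) \<Rightarrow> nat hgraph \<Rightarrow> (nat \<Rightarrow> 'f) \<Rightarrow> nat hgraph" where
  "fprod G \<kappa> G' \<kappa>' =
     (let V = {z. proj1 z \<in> verts G \<and> proj2 z \<in> verts G' \<and> \<kappa> (proj1 z) = \<kappa>' (proj2 z)}
      in \<lparr>verts = V, edges = {e. e \<subseteq> V \<and> proj1 ` e \<in> edges G \<and> proj2 ` e \<in> edges G'}\<rparr>)"

lemma verts_fprod: "verts (fprod G \<kappa> G' \<kappa>') = {z. proj1 z \<in> verts G \<and> proj2 z \<in> verts G' \<and> \<kappa> (proj1 z) = \<kappa>' (proj2 z)}"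
  by (simp add: fprod_def Let_def)

lemma edges_fprod: "edges (fprod G \<kappa> G' \<kappa>') =
   {e. e \<subseteq> verts (fprod G \<kappa> G' \<kappa>') \<and> proj1 ` e \<in> edges G \<and> proj2 ` e \<in> edges G'}"
  by (simp add: fprod_def Let_def)

lemma part_fprod:
  "part (fprod G \<kappa> G' \<kappa>') (\<kappa> \<circ> proj1) a = prod_encode ` (part G \<kappa> a \<times> part G' \<kappa>' a)"
proof (intro equalityI subsetI)
  fix z assume "z \<in> part (fprod G \<kappa> G' \<kappa>') (\<kappa> \<circ> proj1) a"
  hence "z = prod_encode (proj1 z, proj2 z) \<and> (proj1 z, proj2 z) \<in> part G \<kappa> a \<times> part G' \<kappa>' a"
    by (auto simp: part_def verts_fprod mem_Times_iff)
  thus "z \<in> prod_encode ` (part G \<kappa> a \<times> part G' \<kappa>' a)" by blast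
qed (auto simp: part_def verts_fprod)

lemma card_part_fprod:
  "card (part (fprod G \<kappa> G' \<kappa>') (\<kappa> \<circ> proj1) a) = card (part G \<kappa> a) * card (part G' \<kappa>' a)"
  unfolding part_fprod by (subst card_image) (auto simp: card_cartesian_product inj_on_def)

lemma verts_fprod_subset: "verts (fprod G \<kappa> G' \<kappa>') \<subseteq> prod_encode ` (verts G \<times> verts G')"
proof
  fix z assume "z \<in> verts (fprod G \<kappa> G' \<kappa>')"
  hence "z = prod_encode (proj1 z, proj2 z) \<and> (proj1 z, proj2 z) \<in> verts G \<times> verts G'"
    by (auto simp: verts_fprod mem_Times_iff)
  thus "z \<in> prod_encode ` (verts G \<times> verts G')" by blast
qed

lemma finite_verts_fprod: "finite (verts G) \<Longrightarrow> finite (verts G') \<Longrightarrow> finite (verts (fprod G \<kappa> G' \<kappa>'))"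
  by (rule finite_subset[OF verts_fprod_subset]) auto

lemma nverts_fprod_le:
  assumes "finite (verts G)" "finite (verts G')"
  shows "nverts (fprod G \<kappa> G' \<kappa>') \<le> nverts G * nverts G'"
proof -
  have "nverts (fprod G \<kappa> G' \<kappa>') \<le> card (prod_encode ` (verts G \<times> verts G'))"
    by (intro card_mono verts_fprod_subset) (auto simp: assms)
  also have "\<dots> = nverts G * nverts G'"
    by (subst card_image) (auto simp: card_cartesian_product inj_on_def)
  finally show ?thesis .
qed

text \<open>A colour-preserving homomorphism into the product is a pair of such homomorphisms into the factors.\<close>

lemma hom_density_fprod:
  assumes sub: "\<And>e. e \<in> edges H \<Longrightarrow> e \<subseteq> verts H"
  shows "hom_density H \<sigma> (fprod G \<kappa> G' \<kappa>') (\<kappa> \<circ> proj1) = hom_density H \<sigma> G \<kappa> * hom_density H \<sigma> G' \<kappa>'"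
proof -
  let ?P = "fprod G \<kappa> G' \<kappa>'"
  let ?enc = "\<lambda>f g. \<lambda>x\<in>verts H. prod_encode (f x, g x)"
  have inter: "e \<inter> verts H = e" "e \<inter> {x. x \<notin> verts H} = {}" if "e \<in> edges H" for e
    using sub[OF that] by auto
  have im1: "proj1 ` ?enc f g ` e = f ` e" if "e \<in> edges H" for f g e
    unfolding image_image using sub[OF that] by (intro image_cong) (auto simp: subset_iff)
  have im2: "proj2 ` ?enc f g ` e = g ` e" if "e \<in> edges H" for f g e
    unfolding image_image using sub[OF that] by (intro image_cong) (auto simp: subset_iff)
  have "bij_betw (\<lambda>\<phi>. (\<lambda>x\<in>verts H. proj1 (\<phi> x), \<lambda>x\<in>verts H. proj2 (\<phi> x))) (Homs_col H \<sigma> ?P (\<kappa> \<circ> proj1))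
          (Homs_col H \<sigma> G \<kappa> \<times> Homs_col H \<sigma> G' \<kappa>')"
  proof (rule bij_betw_byWitness[where f' = "\<lambda>(f, g). ?enc f g"])
    show "\<forall>\<phi>\<in>Homs_col H \<sigma> ?P (\<kappa> \<circ> proj1).
       (case (\<lambda>x\<in>verts H. proj1 (\<phi> x), \<lambda>x\<in>verts H. proj2 (\<phi> x)) of (f, g) \<Rightarrow> ?enc f g) = \<phi>"
      by (auto simp: Homs_col_def fun_eq_iff PiE_def extensional_def)
    show "\<forall>a'\<in>Homs_col H \<sigma> G \<kappa> \<times> Homs_col H \<sigma> G' \<kappa>'.
       (\<lambda>x\<in>verts H. proj1 ((case a' of (f, g) \<Rightarrow> ?enc f g) x),
        \<lambda>x\<in>verts H. proj2 ((case a' of (f, g) \<Rightarrow> ?enc f g) x)) = a'"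
      by (auto simp: Homs_col_def fun_eq_iff PiE_def extensional_def)
    show "(\<lambda>\<phi>. (\<lambda>x\<in>verts H. proj1 (\<phi> x), \<lambda>x\<in>verts H. proj2 (\<phi> x))) ` Homs_col H \<sigma> ?P (\<kappa> \<circ> proj1)
      \<subseteq> Homs_col H \<sigma> G \<kappa> \<times> Homs_col H \<sigma> G' \<kappa>'"
      by (auto simp: Homs_col_def inter image_image edges_fprod) (auto simp: part_def PiE_def Pi_def verts_fprod)
    show "(\<lambda>(f, g). ?enc f g) ` (Homs_col H \<sigma> G \<kappa> \<times> Homs_col H \<sigma> G' \<kappa>') \<subseteq> Homs_col H \<sigma> ?P (\<kappa> \<circ> proj1)"
    proof clarify
      fix f g assume f: "f \<in> Homs_col H \<sigma> G \<kappa>" and g: "g \<in> Homs_col H \<sigma> G' \<kappa>'"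
      have 1: "?enc f g x \<in> part ?P (\<kappa> \<circ> proj1) (\<sigma> x)" if "x \<in> verts H" for x
        using f g that by (auto simp: Homs_col_def part_def verts_fprod PiE_def Pi_def)
      have "?enc f g ` e \<in> edges ?P" if "e \<in> edges H" for e
      proof -
        have "?enc f g ` e \<subseteq> verts ?P" using 1 sub[OF that] unfolding part_def by blast
        thus ?thesis using f g that unfolding edges_fprod mem_Collect_eq im1[OF that] im2[OF that]
          by (auto simp: Homs_col_def)
      qed
      thus "?enc f g \<in> Homs_col H \<sigma> ?P (\<kappa> \<circ> proj1)" using 1 by (auto simp: Homs_col_def)
    qed
  qed
  hence "card (Homs_col H \<sigma> ?P (\<kappa> \<circ> proj1)) = card (Homs_col H \<sigma> G \<kappa>) * card (Homs_col H \<sigma> G' \<kappa>')"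
    by (simp add: bij_betw_same_card card_cartesian_product flip: card_cartesian_product)
  thus ?thesis unfolding hom_density_def card_part_fprod by (simp add: prod.distrib)
qed

section \<open>Packings and uniform farness\<close>

text \<open>Double counting of incidences between points and copies.\<close>

lemma sum_degrees:
  assumes "finite V" "finite \<C>" "\<And>\<psi>. \<psi> \<in> \<C> \<Longrightarrow> \<psi> ` A \<subseteq> V \<and> inj_on \<psi> A"
  shows "(\<Sum>x\<in>V. card {\<psi> \<in> \<C>. x \<in> \<psi> ` A}) = card \<C> * card A"
proof -
  have "(\<Sum>x\<in>V. card {\<psi> \<in> \<C>. x \<in> \<psi> ` A}) = (\<Sum>x\<in>V. \<Sum>\<psi>\<in>\<C>. if x \<in> \<psi> ` A then 1 else 0)"
    using assms(2) by (simp add: sum.If_cases Int_def)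
  also have "\<dots> = (\<Sum>\<psi>\<in>\<C>. \<Sum>x\<in>V. if x \<in> \<psi> ` A then 1 else 0)"
    by (rule sum.swap)
  also have "\<dots> = (\<Sum>\<psi>\<in>\<C>. card A)"
  proof (rule sum.cong[OF refl])
    fix \<psi> assume "\<psi> \<in> \<C>"
    hence "V \<inter> \<psi> ` A = \<psi> ` A" "inj_on \<psi> A" using assms(3) by blast+
    thus "(\<Sum>x\<in>V. if x \<in> \<psi> ` A then 1 else 0) = card A"
      using assms(1) by (simp add: sum.If_cases card_image)
  qed
  finally show ?thesis by simp
qed

text \<open>The collections of pairwise edge-disjoint colour-preserving copies of \<open>F\<close> in the definition of
uniform farness.\<close>

definition packing :: "'f hgraph \<Rightarrow> 'b hgraph \<Rightarrow> ('b \<Rightarrow> 'f) \<Rightarrow> ('f \<Rightarrow> 'b) set \<Rightarrow> bool" where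
  "packing F G \<kappa> \<C> \<longleftrightarrow> \<C> \<subseteq> Embs F G \<and>
     (\<forall>\<psi>\<in>\<C>. \<forall>\<psi>'\<in>\<C>. \<psi> \<noteq> \<psi>' \<longrightarrow> ((`) \<psi> ` edges F) \<inter> ((`) \<psi>' ` edges F) = {}) \<and>
     (\<forall>\<psi>\<in>\<C>. \<forall>a\<in>verts F. \<kappa> (\<psi> a) = a)"

lemma uniformly_far_iff:
  "uniformly_far r F \<epsilon> (G, \<kappa>) \<longleftrightarrow> (\<exists>\<C>. packing F G \<kappa> \<C> \<and>
     (\<forall>x\<in>verts G. real (card {\<psi> \<in> \<C>. x \<in> \<psi> ` verts F}) \<ge> \<epsilon> * real (nverts G) ^ (r - 1)))"
  by (auto simp: uniformly_far_def packing_def)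

lemma packing_edge_unique:
  assumes "packing F G \<kappa> \<C>" "\<psi> \<in> \<C>" "\<psi>' \<in> \<C>" "e \<in> edges F" "e' \<in> edges F" "\<psi> ` e = \<psi>' ` e'"
  shows "\<psi> = \<psi>'"
  using assms unfolding packing_def by blast

lemma uniformly_far_mono:
  assumes "uniformly_far r F \<epsilon> X" "\<epsilon>' \<le> \<epsilon>"
  shows "uniformly_far r F \<epsilon>' X"
proof -
  obtain G \<kappa> where X: "X = (G, \<kappa>)" by (cases X)
  have "\<epsilon>' * real (nverts G) ^ (r - 1) \<le> \<epsilon> * real (nverts G) ^ (r - 1)"
    using assms by (intro mult_right_mono) auto
  thus ?thesis using assms unfolding X uniformly_far_iff by (meson order_trans)
qed

locale pattern =
  fixes r :: nat and F :: "'f hgraph"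
  assumes r_ge_2: "2 \<le> r" and rgraph_F: "rgraph r F" and edges_F: "edges F \<noteq> {}"
    and covered: "a \<in> verts F \<Longrightarrow> \<exists>e\<in>edges F. a \<in> e"
begin

lemma finite_verts_F [simp]: "finite (verts F)"
  using rgraph_F by (simp add: rgraph_def)

lemma finite_edges_F [simp]: "finite (edges F)"
  using rgraph_F by (rule finite_edges)

lemma edge_F: "e \<in> edges F \<Longrightarrow> e \<subseteq> verts F" "e \<in> edges F \<Longrightarrow> card e = r"
  using rgraph_F by (auto simp: rgraph_def)

lemma r_le_nverts_F: "r \<le> nverts F"
proof -
  obtain e where "e \<in> edges F" using edges_F by blast
  thus ?thesis using edge_F card_mono[OF finite_verts_F] by metis
qed

lemma nverts_F_pos: "0 < nverts F"
  using r_le_nverts_F r_ge_2 by linarith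

text \<open>Nonempty parts give meaning to densities and keep fibre products nonempty.\<close>

definition uniform_host :: "real \<Rightarrow> nat hgraph \<Rightarrow> (nat \<Rightarrow> 'f) \<Rightarrow> bool" where
  "uniform_host \<epsilon> G \<kappa> \<longleftrightarrow> coloured r F (G, \<kappa>) \<and> uniformly_far r F \<epsilon> (G, \<kappa>) \<and> (\<forall>a\<in>verts F. part G \<kappa> a \<noteq> {})"

lemma uniform_host_mono: "uniform_host \<epsilon> G \<kappa> \<Longrightarrow> \<epsilon>' \<le> \<epsilon> \<Longrightarrow> uniform_host \<epsilon>' G \<kappa>"
  using uniformly_far_mono by (auto simp: uniform_host_def)

lemma colouring_inj_on_edge:
  assumes "coloured r F (G, \<kappa>)" "e \<in> edges G"
  shows "inj_on \<kappa> e"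
proof (rule eq_card_imp_inj_on)
  have "\<kappa> ` e \<in> edges F" "card e = r" using assms by (auto simp: coloured_def homomorphism_def rgraph_def)
  thus "card (\<kappa> ` e) = card e" using edge_F by simp
  show "finite e" using \<open>card e = r\<close> r_ge_2 card.infinite by force
qed

lemma coloured_fprod:
  assumes G: "coloured r F (G, \<kappa>)" and G': "coloured r F (G', \<kappa>')"
  shows "coloured r F (fprod G \<kappa> G' \<kappa>', \<kappa> \<circ> proj1)"
proof -
  let ?P = "fprod G \<kappa> G' \<kappa>'"
  have edge: "card e = r \<and> (\<kappa> \<circ> proj1) ` e \<in> edges F" if e: "e \<in> edges ?P" for e
  proof -
    have e': "e \<subseteq> verts ?P" "proj1 ` e \<in> edges G" "proj2 ` e \<in> edges G'"
      using e by (auto simp: edges_fprod)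
    have k: "\<kappa> (proj1 z) = \<kappa>' (proj2 z)" if "z \<in> e" for z using e'(1) that by (auto simp: verts_fprod)
    have "inj_on proj1 e"
    proof (rule inj_onI)
      fix z w assume zw: "z \<in> e" "w \<in> e" "proj1 z = proj1 w"
      hence "\<kappa>' (proj2 z) = \<kappa>' (proj2 w)" using k by metis
      hence "proj2 z = proj2 w"
        using colouring_inj_on_edge[OF G' e'(3)] zw by (auto simp: inj_on_def)
      thus "z = w" using zw(3) by (metis prod.collapse prod_decode_inverse)
    qed
    hence "card e = card (proj1 ` e)" by (simp add: card_image)
    moreover have "card (proj1 ` e) = r" "\<kappa> ` proj1 ` e \<in> edges F"
      using G e' by (auto simp: coloured_def homomorphism_def rgraph_def)
    ultimately show ?thesis by (simp add: image_comp)
  qed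
  have "finite (verts ?P)"
    using G G' by (intro finite_verts_fprod) (auto simp: coloured_def rgraph_def)
  moreover have "\<kappa> \<circ> proj1 \<in> verts ?P \<rightarrow> verts F"
  proof
    fix z assume "z \<in> verts ?P"
    hence "proj1 z \<in> verts G" by (simp add: verts_fprod)
    thus "(\<kappa> \<circ> proj1) z \<in> verts F" using G by (auto simp: coloured_def homomorphism_def)
  qed
  moreover have "e \<subseteq> verts ?P" if "e \<in> edges ?P" for e
    using that by (simp add: edges_fprod)
  ultimately show ?thesis using edge
    unfolding coloured_def prod.case rgraph_def homomorphism_def by blast
qed

text \<open>If two product copies share an edge, then so do their projections to either factor, and hence
both pairs of factors coincide.\<close>

lemma packing_fprod:
  assumes C: "packing F G \<kappa> \<C>" and C': "packing F G' \<kappa>' \<C>'"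
  shows "packing F (fprod G \<kappa> G' \<kappa>') (\<kappa> \<circ> proj1)
           ((\<lambda>(\<psi>, \<psi>'). \<lambda>a\<in>verts F. prod_encode (\<psi> a, \<psi>' a)) ` (\<C> \<times> \<C>'))"
proof -
  let ?P = "fprod G \<kappa> G' \<kappa>'"
  define pr where "pr \<psi> \<psi>' = (\<lambda>a\<in>verts F. prod_encode (\<psi> a, \<psi>' a))" for \<psi> \<psi>' :: "'f \<Rightarrow> nat"
  have im: "proj1 ` pr \<psi> \<psi>' ` e = \<psi> ` e" "proj2 ` pr \<psi> \<psi>' ` e = \<psi>' ` e" if "e \<in> edges F" for \<psi> \<psi>' e
    unfolding image_image pr_def using edge_F(1)[OF that] by (auto intro!: image_cong)
  have can: "\<kappa> (\<psi> a) = a" if "\<psi> \<in> \<C>" "a \<in> verts F" for \<psi> a using C that by (auto simp: packing_def)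
  have can': "\<kappa>' (\<psi> a) = a" if "\<psi> \<in> \<C>'" "a \<in> verts F" for \<psi> a using C' that by (auto simp: packing_def)
  have emb: "pr \<psi> \<psi>' \<in> Embs F ?P" if "\<psi> \<in> \<C>" "\<psi>' \<in> \<C>'" for \<psi> \<psi>'
  proof -
    have E: "\<psi> \<in> Embs F G" "\<psi>' \<in> Embs F G'" using C C' that by (auto simp: packing_def)
    have v: "pr \<psi> \<psi>' a \<in> verts ?P" if "a \<in> verts F" for a
      using E that can[OF \<open>\<psi> \<in> \<C>\<close>] can'[OF \<open>\<psi>' \<in> \<C>'\<close>]
      by (auto simp: pr_def verts_fprod Embs_def embedding_def homomorphism_def)
    have "pr \<psi> \<psi>' ` e \<in> edges ?P" if "e \<in> edges F" for e
      unfolding edges_fprod mem_Collect_eq im[OF that]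
      using v edge_F[OF that] E that by (auto simp: Embs_def embedding_def homomorphism_def)
    moreover have "inj_on (pr \<psi> \<psi>') (verts F)"
      by (rule inj_on_inverseI[where g = "\<lambda>z. \<kappa> (proj1 z)"]) (use that can in \<open>auto simp: pr_def\<close>)
    ultimately show ?thesis using v
      by (auto simp: Embs_def embedding_def homomorphism_def) (simp add: pr_def)
  qed
  have disj: "pr \<psi> \<psi>' = pr \<theta> \<theta>'"
    if "\<psi> \<in> \<C>" "\<psi>' \<in> \<C>'" "\<theta> \<in> \<C>" "\<theta>' \<in> \<C>'" "e \<in> edges F" "f \<in> edges F" "pr \<psi> \<psi>' ` e = pr \<theta> \<theta>' ` f"
    for \<psi> \<psi>' \<theta> \<theta>' e f
  proof -
    have "\<psi> ` e = \<theta> ` f" "\<psi>' ` e = \<theta>' ` f" using that im by metis+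
    hence "\<psi> = \<theta>" "\<psi>' = \<theta>'" using that packing_edge_unique[OF C] packing_edge_unique[OF C'] by metis+
    thus ?thesis by simp
  qed
  show ?thesis
    unfolding packing_def pr_def[symmetric]
  proof (intro conjI)
    show "\<forall>\<psi>\<in>(\<lambda>(x, y). pr x y) ` (\<C> \<times> \<C>'). \<forall>a\<in>verts F. (\<kappa> \<circ> proj1) (\<psi> a) = a"
      using can by (auto simp: pr_def)
    show "(\<lambda>(x, y). pr x y) ` (\<C> \<times> \<C>') \<subseteq> Embs F ?P" using emb by auto
    show "\<forall>\<alpha>\<in>(\<lambda>(x, y). pr x y) ` (\<C> \<times> \<C>'). \<forall>\<beta>\<in>(\<lambda>(x, y). pr x y) ` (\<C> \<times> \<C>').
        \<alpha> \<noteq> \<beta> \<longrightarrow> (`) \<alpha> ` edges F \<inter> (`) \<beta> ` edges F = {}"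
    proof (intro ballI impI)
      fix \<alpha> \<beta> assume "\<alpha> \<in> (\<lambda>(x, y). pr x y) ` (\<C> \<times> \<C>')" "\<beta> \<in> (\<lambda>(x, y). pr x y) ` (\<C> \<times> \<C>')" "\<alpha> \<noteq> \<beta>"
      then obtain \<psi> \<psi>' \<theta> \<theta>' where *: "\<psi> \<in> \<C>" "\<psi>' \<in> \<C>'" "\<theta> \<in> \<C>" "\<theta>' \<in> \<C>'"
        "\<alpha> = pr \<psi> \<psi>'" "\<beta> = pr \<theta> \<theta>'" by auto
      show "(`) \<alpha> ` edges F \<inter> (`) \<beta> ` edges F = {}"
        using disj[OF *(1-4)] \<open>\<alpha> \<noteq> \<beta>\<close> unfolding *(5,6) by blast
    qed
  qed
qed

text \<open>The copies through a pair of vertices include all pairs of copies through the two vertices: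
copies preserve colours, so a copy through either vertex meets it at the same vertex of \<open>F\<close>.
So degrees multiply, while the number of vertices of the product is at most the product of
the numbers of vertices.\<close>

lemma uniform_host_fprod:
  assumes "uniform_host \<epsilon> G \<kappa>" "uniform_host \<epsilon>' G' \<kappa>'" "0 \<le> \<epsilon>" "0 \<le> \<epsilon>'"
  shows "uniform_host (\<epsilon> * \<epsilon>') (fprod G \<kappa> G' \<kappa>') (\<kappa> \<circ> proj1)"
proof -
  let ?P = "fprod G \<kappa> G' \<kappa>'"
  let ?pr = "\<lambda>(\<psi>, \<psi>'). \<lambda>a\<in>verts F. prod_encode (\<psi> a, \<psi>' a)"
  have col: "coloured r F (G, \<kappa>)" "coloured r F (G', \<kappa>')" using assms by (auto simp: uniform_host_def)
  have fin: "finite (verts G)" "finite (verts G')" using col by (auto simp: coloured_def rgraph_def)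
  obtain \<C> where C: "packing F G \<kappa> \<C>"
    and degC: "\<And>x. x \<in> verts G \<Longrightarrow> real (card {\<psi> \<in> \<C>. x \<in> \<psi> ` verts F}) \<ge> \<epsilon> * real (nverts G) ^ (r - 1)"
    using assms by (auto simp: uniform_host_def uniformly_far_iff)
  obtain \<C>' where C': "packing F G' \<kappa>' \<C>'"
    and degC': "\<And>x. x \<in> verts G' \<Longrightarrow> real (card {\<psi> \<in> \<C>'. x \<in> \<psi> ` verts F}) \<ge> \<epsilon>' * real (nverts G') ^ (r - 1)"
    using assms by (auto simp: uniform_host_def uniformly_far_iff)
  have can: "\<kappa> (\<psi> a) = a" if "\<psi> \<in> \<C>" "a \<in> verts F" for \<psi> a using C that by (auto simp: packing_def)
  have can': "\<kappa>' (\<psi> a) = a" if "\<psi> \<in> \<C>'" "a \<in> verts F" for \<psi> a using C' that by (auto simp: packing_def)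
  have finC: "finite \<C>" "finite \<C>'" using C C' fin finite_Embs[OF finite_verts_F] finite_subset
    by (auto simp: packing_def)
  have ext: "\<psi> \<in> extensional (verts F)" if "\<psi> \<in> \<C> \<or> \<psi> \<in> \<C>'" for \<psi>
    using that C C' by (auto simp: packing_def Embs_def)
  have inj: "inj_on ?pr (\<C> \<times> \<C>')"
  proof (rule inj_onI, clarify)
    fix \<psi> \<psi>' \<theta> \<theta>'
    assume *: "\<psi> \<in> \<C>" "\<psi>' \<in> \<C>'" "\<theta> \<in> \<C>" "\<theta>' \<in> \<C>'"
      "(\<lambda>a\<in>verts F. prod_encode (\<psi> a, \<psi>' a)) = (\<lambda>a\<in>verts F. prod_encode (\<theta> a, \<theta>' a))"
    have "\<psi> a = \<theta> a \<and> \<psi>' a = \<theta>' a" if "a \<in> verts F" for a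
      using fun_cong[OF *(5), of a] that by simp
    thus "\<psi> = \<theta> \<and> \<psi>' = \<theta>'" using * ext by (blast intro: extensionalityI)
  qed
  have deg: "real (card {\<psi> \<in> ?pr ` (\<C> \<times> \<C>'). z \<in> \<psi> ` verts F}) \<ge> \<epsilon> * \<epsilon>' * real (nverts ?P) ^ (r - 1)"
    if z: "z \<in> verts ?P" for z
  proof -
    let ?D = "{\<psi> \<in> \<C>. proj1 z \<in> \<psi> ` verts F}" and ?D' = "{\<psi> \<in> \<C>'. proj2 z \<in> \<psi> ` verts F}"
    have z': "proj1 z \<in> verts G" "proj2 z \<in> verts G'" "\<kappa> (proj1 z) = \<kappa>' (proj2 z)" using z by (auto simp: verts_fprod)
    have "?pr ` (?D \<times> ?D') \<subseteq> {\<psi> \<in> ?pr ` (\<C> \<times> \<C>'). z \<in> \<psi> ` verts F}"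
    proof clarify
      fix \<psi> \<psi>' a b assume *: "\<psi> \<in> \<C>" "\<psi>' \<in> \<C>'" "proj1 z = \<psi> a" "a \<in> verts F" "proj2 z = \<psi>' b" "b \<in> verts F"
      hence "a = b" using z'(3) can can' by metis
      hence "z = (\<lambda>a\<in>verts F. prod_encode (\<psi> a, \<psi>' a)) a"
        using * by simp (metis prod.collapse prod_decode_inverse)
      hence "z \<in> (\<lambda>a\<in>verts F. prod_encode (\<psi> a, \<psi>' a)) ` verts F"
        using *(4) by (rule image_eqI)
      thus "(\<lambda>a\<in>verts F. prod_encode (\<psi> a, \<psi>' a)) \<in> ?pr ` (\<C> \<times> \<C>') \<and>
            z \<in> (\<lambda>a\<in>verts F. prod_encode (\<psi> a, \<psi>' a)) ` verts F"
        using * by (intro conjI image_eqI[OF _ SigmaI]) auto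
    qed
    hence "card (?pr ` (?D \<times> ?D')) \<le> card {\<psi> \<in> ?pr ` (\<C> \<times> \<C>'). z \<in> \<psi> ` verts F}"
      by (intro card_mono) (use finC in auto)
    moreover have "card (?pr ` (?D \<times> ?D')) = card ?D * card ?D'"
      by (subst card_image) (auto intro: inj_on_subset[OF inj] simp: card_cartesian_product)
    ultimately have "real (card ?D) * real (card ?D') \<le> real (card {\<psi> \<in> ?pr ` (\<C> \<times> \<C>'). z \<in> \<psi> ` verts F})"
      by (simp only: of_nat_mult[symmetric] of_nat_le_iff)
    moreover have "(\<epsilon> * real (nverts G) ^ (r - 1)) * (\<epsilon>' * real (nverts G') ^ (r - 1)) \<le> real (card ?D) * real (card ?D')"
      using degC[OF z'(1)] degC'[OF z'(2)] assms by (intro mult_mono) auto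
    moreover have "\<epsilon> * \<epsilon>' * real (nverts ?P) ^ (r - 1) \<le> \<epsilon> * \<epsilon>' * (real (nverts G) * real (nverts G')) ^ (r - 1)"
      using nverts_fprod_le[OF fin, of \<kappa> \<kappa>'] assms
      by (intro mult_left_mono power_mono) (auto simp flip: of_nat_mult)
    ultimately show ?thesis by (simp add: power_mult_distrib algebra_simps)
  qed
  have "uniformly_far r F (\<epsilon> * \<epsilon>') (?P, \<kappa> \<circ> proj1)"
    unfolding uniformly_far_iff using packing_fprod[OF C C'] deg by blast
  moreover have "part ?P (\<kappa> \<circ> proj1) a \<noteq> {}" if "a \<in> verts F" for a
    using assms that by (auto simp: uniform_host_def part_fprod)
  ultimately show ?thesis using coloured_fprod[OF col] by (simp add: uniform_host_def)
qed

lemma uniform_host_power: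
  assumes "uniform_host \<epsilon> G \<kappa>" "0 \<le> \<epsilon>" "1 \<le> l"
  shows "\<exists>G' \<kappa>'. uniform_host (\<epsilon> ^ l) G' \<kappa>' \<and>
    (\<forall>(H :: 'a hgraph) \<sigma>. rgraph r H \<longrightarrow> hom_density H \<sigma> G' \<kappa>' = hom_density H \<sigma> G \<kappa> ^ l)"
  using assms(3)
proof (induction l rule: dec_induct)
  case base
  thus ?case using assms by auto
next
  case (step l)
  then obtain G' \<kappa>' where "uniform_host (\<epsilon> ^ l) G' \<kappa>'"
    and d: "\<And>(H :: 'a hgraph) \<sigma>. rgraph r H \<Longrightarrow> hom_density H \<sigma> G' \<kappa>' = hom_density H \<sigma> G \<kappa> ^ l" by auto
  with assms have "uniform_host (\<epsilon> ^ Suc l) (fprod G \<kappa> G' \<kappa>') (\<kappa> \<circ> proj1)"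
    using uniform_host_fprod[of \<epsilon> G \<kappa> "\<epsilon> ^ l" G' \<kappa>'] by simp
  moreover have "hom_density H \<sigma> (fprod G \<kappa> G' \<kappa>') (\<kappa> \<circ> proj1) = hom_density H \<sigma> G \<kappa> ^ Suc l"
    if "rgraph r H" for H :: "'a hgraph" and \<sigma>
    using that by (subst hom_density_fprod) (auto simp: d rgraph_def)
  ultimately show ?case by blast
qed

lemma packing_finite:
  assumes "packing F G \<kappa> \<C>" "finite (verts G)"
  shows "finite \<C>"
  using assms finite_Embs[OF finite_verts_F] finite_subset by (auto simp: packing_def)

lemma packing_size_ge:
  assumes C: "packing F G \<kappa> \<C>" and G: "finite (verts G)"
    and deg: "\<And>x. x \<in> verts G \<Longrightarrow> real (card {\<psi> \<in> \<C>. x \<in> \<psi> ` verts F}) \<ge> \<epsilon> * real (nverts G) ^ (r - 1)"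
  shows "\<epsilon> * real (nverts G) ^ r \<le> real (card \<C>) * real (nverts F)"
proof -
  have "\<epsilon> * real (nverts G) ^ r = (\<Sum>x\<in>verts G. \<epsilon> * real (nverts G) ^ (r - 1))"
    using r_ge_2 by (simp add: power_eq_if)
  also have "\<dots> \<le> (\<Sum>x\<in>verts G. real (card {\<psi> \<in> \<C>. x \<in> \<psi> ` verts F}))"
    by (intro sum_mono deg)
  also have "\<dots> = real (\<Sum>x\<in>verts G. card {\<psi> \<in> \<C>. x \<in> \<psi> ` verts F})" by simp
  also have "\<dots> = real (card \<C> * nverts F)"
    using C by (subst sum_degrees[OF G packing_finite[OF C G]])
      (auto simp: packing_def Embs_def embedding_def homomorphism_def)
  finally show ?thesis by simp
qed

text \<open>A copy in a packing is determined by the image of a single edge of \<open>F\<close>; take an edge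
containing \<open>a\<close>.\<close>

lemma packing_size_le:
  assumes C: "packing F G \<kappa> \<C>" and G: "finite (verts G)" and a: "a \<in> verts F"
  shows "card \<C> \<le> card (part G \<kappa> a) * nverts G ^ (r - 1)"
proof -
  obtain e where e: "e \<in> edges F" "a \<in> e" using covered[OF a] by blast
  have eF: "e \<subseteq> verts F" "card e = r" "finite e"
    using edge_F[OF e(1)] finite_subset[OF _ finite_verts_F] by auto
  have can: "\<psi> b \<in> part G \<kappa> b" if "\<psi> \<in> \<C>" "b \<in> verts F" for \<psi> b
    using C that by (auto simp: packing_def part_def Embs_def embedding_def homomorphism_def)
  have "card \<C> \<le> card (\<Pi>\<^sub>E b\<in>e. part G \<kappa> b)"
  proof (rule card_inj_on_le)
    show "inj_on (\<lambda>\<psi>. restrict \<psi> e) \<C>"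
    proof (rule inj_onI)
      fix \<psi> \<theta> assume *: "\<psi> \<in> \<C>" "\<theta> \<in> \<C>" "restrict \<psi> e = restrict \<theta> e"
      have "\<psi> ` e = \<theta> ` e" using *(3) by (metis image_restrict_eq)
      thus "\<psi> = \<theta>" using packing_edge_unique[OF C *(1,2) e(1) e(1)] by blast
    qed
    show "(\<lambda>\<psi>. restrict \<psi> e) ` \<C> \<subseteq> (\<Pi>\<^sub>E b\<in>e. part G \<kappa> b)" using can eF by auto
  qed (use eF G in \<open>auto intro!: finite_PiE\<close>)
  also have "\<dots> = card (part G \<kappa> a) * (\<Prod>b\<in>e - {a}. card (part G \<kappa> b))"
    using eF e by (simp add: card_PiE prod.remove[of e a])
  also have "\<dots> \<le> card (part G \<kappa> a) * (\<Prod>b\<in>e - {a}. nverts G)"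
    by (intro mult_left_mono prod_mono) (auto simp: card_part_le G)
  also have "(\<Prod>b\<in>e - {a}. nverts G) = nverts G ^ (r - 1)" using eF e by simp
  finally show ?thesis .
qed

lemma uniformly_far_part_ge:
  assumes far: "uniformly_far r F \<epsilon> (G, \<kappa>)" and G: "finite (verts G)" and a: "a \<in> verts F"
  shows "\<epsilon> * real (nverts G) / real (nverts F) \<le> real (card (part G \<kappa> a))"
proof (cases "nverts G = 0")
  case False
  obtain \<C> where C: "packing F G \<kappa> \<C>"
    and degC: "\<And>x. x \<in> verts G \<Longrightarrow> real (card {\<psi> \<in> \<C>. x \<in> \<psi> ` verts F}) \<ge> \<epsilon> * real (nverts G) ^ (r - 1)"
    using far by (auto simp: uniformly_far_iff)
  let ?n = "real (nverts G)"
  have "(\<epsilon> * ?n) * ?n ^ (r - 1) = \<epsilon> * ?n ^ r" using r_ge_2 by (simp add: power_eq_if)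
  also have "\<dots> \<le> real (card \<C>) * real (nverts F)" by (rule packing_size_ge[OF C G degC])
  also have "\<dots> \<le> real (card (part G \<kappa> a) * nverts G ^ (r - 1)) * real (nverts F)"
    using packing_size_le[OF C G a] by (intro mult_right_mono of_nat_mono) auto
  also have "\<dots> = (real (card (part G \<kappa> a)) * real (nverts F)) * ?n ^ (r - 1)" by simp
  finally have "\<epsilon> * ?n \<le> real (card (part G \<kappa> a)) * real (nverts F)"
    using False by (simp add: mult_le_cancel_right)
  thus ?thesis using nverts_F_pos by (simp add: field_simps)
qed auto

text \<open>A set of edges meeting all copies of \<open>F\<close> has to contain an edge of each member of an edge-disjoint
collection.\<close>

lemma uniformly_far_imp_far:
  assumes ufar: "uniformly_far r F \<epsilon> (G, \<kappa>)" and col: "coloured r F (G, \<kappa>)"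
  shows "far r F (\<epsilon> / real (nverts F)) G"
  unfolding far_def
proof (intro allI impI)
  fix D assume D: "D \<subseteq> edges G" "free_of F (del_edges G D)"
  have G: "rgraph r G" "finite (verts G)" using col by (auto simp: coloured_def rgraph_def)
  obtain \<C> where C: "packing F G \<kappa> \<C>"
    and degC: "\<And>x. x \<in> verts G \<Longrightarrow> real (card {\<psi> \<in> \<C>. x \<in> \<psi> ` verts F}) \<ge> \<epsilon> * real (nverts G) ^ (r - 1)"
    using ufar by (auto simp: uniformly_far_iff)
  have "\<exists>e\<in>edges F. \<psi> ` e \<in> D" if "\<psi> \<in> \<C>" for \<psi>
  proof (rule ccontr)
    assume "\<not> (\<exists>e\<in>edges F. \<psi> ` e \<in> D)"
    hence "embedding F (del_edges G D) \<psi>" using C that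
      by (auto simp: packing_def Embs_def embedding_def homomorphism_def del_edges_def)
    thus False using D by (auto simp: free_of_def)
  qed
  then obtain f where f: "\<And>\<psi>. \<psi> \<in> \<C> \<Longrightarrow> f \<psi> \<in> edges F \<and> \<psi> ` f \<psi> \<in> D" by metis
  have "card \<C> \<le> card D"
  proof (rule card_inj_on_le[where f = "\<lambda>\<psi>. \<psi> ` f \<psi>"])
    show "inj_on (\<lambda>\<psi>. \<psi> ` f \<psi>) \<C>"
    proof (rule inj_onI)
      fix \<psi> \<theta> assume *: "\<psi> \<in> \<C>" "\<theta> \<in> \<C>" "\<psi> ` f \<psi> = \<theta> ` f \<theta>"
      show "\<psi> = \<theta>" using packing_edge_unique[OF C *(1,2) _ _ *(3)] f * by blast
    qed
    show "finite D" using D finite_edges[OF G(1)] finite_subset by blast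
  qed (use f in auto)
  hence "\<epsilon> * real (nverts G) ^ r \<le> real (card D) * real (nverts F)"
    using packing_size_ge[OF C G(2) degC] mult_right_mono[of "real (card \<C>)" "real (card D)" "real (nverts F)"]
    by simp
  thus "\<epsilon> / real (nverts F) * real (nverts G) ^ r \<le> real (card D)"
    using nverts_F_pos by (simp add: field_simps)
qed

end

section \<open>Hosts from polynomials over a prime field\<close>

text \<open>A nonzero polynomial over the field with \<open>m\<close> elements has at most as many roots as its degree,
stated for integer polynomials modulo \<open>m\<close> so that \<open>m\<close> can vary.\<close>

lemma poly_zero_mod_prime:
  fixes p :: "int poly" and m :: int
  assumes "prime m" "finite A" "degree p < card A" "\<And>a. a \<in> A \<Longrightarrow> m dvd poly p a"
    and "\<And>a b. a \<in> A \<Longrightarrow> b \<in> A \<Longrightarrow> m dvd a - b \<Longrightarrow> a = b"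
  shows "m dvd coeff p i"
  using assms(2-)
proof (induction A arbitrary: p i rule: finite_induct)
  case (insert a A)
  define q where "q = synthetic_div p a"
  have p: "p = [:- a, 1:] * q + [:poly p a:]"
    unfolding q_def by (rule synthetic_div_correct' [symmetric])
  have pa: "m dvd poly p a" using insert.prems by simp
  have q: "m dvd coeff q j" for j
  proof (cases "degree p = 0")
    case True
    hence "q = 0" by (simp add: q_def synthetic_div_eq_0_iff)
    thus ?thesis by simp
  next
    case False
    show ?thesis
    proof (rule insert.IH)
      show "degree q < card A" using False insert.prems(1) insert.hyps by (simp add: q_def degree_synthetic_div)
      fix b assume b: "b \<in> A"
      have "m dvd poly p b" using b insert.prems by simp
      moreover have "poly p b = (b - a) * poly q b + poly p a"
        using arg_cong[OF p, of "\<lambda>p. poly p b"] by (simp add: algebra_simps)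
      ultimately have "m dvd (b - a) * poly q b" using pa by (simp add: dvd_add_left_iff)
      moreover have "\<not> m dvd b - a" using insert.prems(3)[of b a] b insert.hyps by auto
      ultimately show "m dvd poly q b" using \<open>prime m\<close> by (simp add: prime_dvd_mult_iff)
    qed (use insert.prems in auto)
  qed
  show ?case
    by (subst p) (use q pa in \<open>auto simp: coeff_pCons split: nat.split\<close>)
qed auto

text \<open>The value at \<open>j\<close> of the polynomial with coefficients \<open>s 0, \<dots>, s (d - 1)\<close> over the field with
\<open>m\<close> elements, that is, the entry at \<open>j\<close> of a word of a Reed-Solomon code.\<close>

definition rs_value :: "nat \<Rightarrow> nat \<Rightarrow> (nat \<Rightarrow> nat) \<Rightarrow> nat \<Rightarrow> nat" where
  "rs_value m d s j = (\<Sum>i<d. s i * j ^ i) mod m"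

lemma rs_value_less: "m > 0 \<Longrightarrow> rs_value m d s j < m"
  by (simp add: rs_value_def)

lemma rs_value_inj:
  assumes m: "prime m" and s: "s \<in> {..<d} \<rightarrow>\<^sub>E {..<m}" "s' \<in> {..<d} \<rightarrow>\<^sub>E {..<m}"
    and J: "J \<subseteq> {..<m}" "d \<le> card J" "0 < d"
    and eq: "\<And>j. j \<in> J \<Longrightarrow> rs_value m d s j = rs_value m d s' j"
  shows "s = s'"
proof (rule PiE_ext[OF s])
  fix i assume "i \<in> {..<d}"
  define p where "p = (\<Sum>i<d. monom (int (s i) - int (s' i)) i)"
  have co: "coeff p i = (if i < d then int (s i) - int (s' i) else 0)" for i
    by (auto simp: p_def coeff_sum)
  have "degree p \<le> d - 1" by (rule degree_le) (auto simp: co)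
  hence deg: "degree p < card (int ` J)" using J by (subst card_image) auto
  have "int m dvd coeff p i"
  proof (rule poly_zero_mod_prime[OF _ _ deg])
    show "prime (int m)" using m by simp
    show "finite (int ` J)" using J finite_subset by blast
    fix a assume "a \<in> int ` J"
    then obtain j where j: "j \<in> J" "a = int j" by auto
    have "[(\<Sum>i<d. s i * j ^ i) = (\<Sum>i<d. s' i * j ^ i)] (mod m)"
      using eq[OF j(1)] by (simp add: rs_value_def cong_def)
    hence "int m dvd int (\<Sum>i<d. s i * j ^ i) - int (\<Sum>i<d. s' i * j ^ i)"
      by (simp only: cong_int_iff[symmetric] cong_iff_dvd_diff)
    thus "int m dvd poly p a"
      by (simp add: p_def j poly_sum poly_monom sum_subtractf left_diff_distrib)
  next
    fix a b assume ab: "a \<in> int ` J" "b \<in> int ` J" "int m dvd a - b"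
    hence "a mod int m = b mod int m" by (simp add: mod_eq_dvd_iff)
    thus "a = b" using ab J by (auto simp: subset_iff)
  qed
  hence "int m dvd int (s i) - int (s' i)" using \<open>i \<in> {..<d}\<close> by (simp add: co)
  hence "int (s i) mod int m = int (s' i) mod int m" by (simp add: mod_eq_dvd_iff)
  thus "s i = s' i" using s \<open>i \<in> {..<d}\<close> by (auto simp: PiE_iff zmod_int[symmetric])
qed

text \<open>The nonconstant coefficients may be chosen freely, and the constant one adjusts the value.\<close>

lemma card_rs_value_ge:
  assumes m: "0 < m" "0 < d" "y < m"
  shows "m ^ (d - 1) \<le> card {s \<in> {..<d} \<rightarrow>\<^sub>E {..<m}. rs_value m d s j = y}"
proof -
  let ?S = "{1..<d} \<rightarrow>\<^sub>E {..<m}"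
  define T where "T g = (\<Sum>i=1..<d. g i * j ^ i)" for g :: "nat \<Rightarrow> nat"
  define c where "c g = (y + (m - T g mod m)) mod m" for g
  define ext where "ext g = g(0 := c g)" for g
  have val: "rs_value m d (ext g) j = y" for g
  proof -
    have "(\<Sum>i<d. ext g i * j ^ i) = c g + T g"
      using \<open>0 < d\<close> unfolding T_def lessThan_atLeast0
      by (subst sum.atLeast_Suc_lessThan) (auto simp: ext_def intro!: sum.cong)
    also have "\<dots> mod m = (y + (m - T g mod m) + T g mod m) mod m"
      unfolding c_def by (simp add: mod_simps)
    also have "y + (m - T g mod m) + T g mod m = y + m"
      using mod_less_divisor[OF m(1), of "T g"] by linarith
    finally show ?thesis using m by (simp add: rs_value_def)
  qed
  have "m ^ (d - 1) = card ?S" by (simp add: card_PiE)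
  also have "\<dots> \<le> card {s \<in> {..<d} \<rightarrow>\<^sub>E {..<m}. rs_value m d s j = y}"
  proof (rule card_inj_on_le)
    show "inj_on ext ?S"
    proof (rule inj_onI, rule PiE_ext)
      fix g h i assume gh: "g \<in> ?S" "h \<in> ?S" "ext g = ext h" and i: "i \<in> {1..<d}"
      have "ext g i = ext h i" using gh by simp
      thus "g i = h i" using i by (simp add: ext_def)
    qed auto
    show "ext ` ?S \<subseteq> {s \<in> {..<d} \<rightarrow>\<^sub>E {..<m}. rs_value m d s j = y}"
      using val m by (auto simp: ext_def c_def PiE_iff extensional_def)
    show "finite {s \<in> {..<d} \<rightarrow>\<^sub>E {..<m}. rs_value m d s j = y}"
      by (intro finite_Collect_conjI disjI1) (auto intro: finite_PiE)
  qed
  finally show ?thesis .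
qed

text \<open>A vertex of an edge is determined by its colour and the other vertices of the edge, so that a
homomorphism has no freedom at a new vertex that completes an edge.\<close>

definition determined :: "'b hgraph \<Rightarrow> ('b \<Rightarrow> 'f) \<Rightarrow> bool" where
  "determined G \<kappa> \<longleftrightarrow> (\<forall>e\<in>edges G. \<forall>e'\<in>edges G. \<forall>x\<in>e. \<forall>x'\<in>e'.
        \<kappa> x = \<kappa> x' \<and> e - {x} = e' - {x'} \<longrightarrow> x = x')"

context pattern
begin

text \<open>The vertices are the pairs of a vertex of \<open>F\<close> and a residue modulo \<open>m\<close>, and every polynomial of
degree less than \<open>d\<close> contributes the copy of \<open>F\<close> on its graph, where the vertices of \<open>F\<close> serve as
evaluation points. Two polynomials that agree at \<open>d\<close> points are equal. As \<open>d \<le> r\<close>, an edge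
determines its copy, so that the copies are edge-disjoint; if \<open>d < r\<close>, already \<open>r - 1\<close> vertices
of an edge do. Every vertex lies on \<open>m\<^sup>d\<^sup>-\<^sup>1\<close> copies.\<close>

lemma rs_graph_exists:
  assumes m: "prime m" "nverts F \<le> m" and d: "1 \<le> d" "d \<le> r"
  shows "\<exists>G \<kappa>. uniform_host (real m ^ (d - 1) / (real (nverts F) * real m) ^ (r - 1)) G \<kappa> \<and>
     (\<forall>a\<in>verts F. card (part G \<kappa> a) = m) \<and>
     (d < r \<longrightarrow> determined G \<kappa>)"
proof -
  obtain idx where bij: "bij_betw idx (verts F) {0..<nverts F}"
    using ex_bij_betw_finite_nat[OF finite_verts_F] by blast
  have idx: "inj_on idx (verts F)" "\<And>a. a \<in> verts F \<Longrightarrow> idx a < m"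
    using bij bij_betwE[OF bij] m(2) by (auto simp: bij_betw_def intro: less_le_trans)
  have m0: "0 < m" using m(1) prime_gt_0_nat by blast
  define S where "S = {..<d} \<rightarrow>\<^sub>E {..<m}"
  define V where "V = (\<lambda>(a, y). prod_encode (idx a, y)) ` (verts F \<times> {..<m})"
  define \<kappa> where "\<kappa> z = inv_into (verts F) idx (proj1 z)" for z
  define \<psi> where "\<psi> s = (\<lambda>a\<in>verts F. prod_encode (idx a, rs_value m d s (idx a)))" for s
  define G where "G = \<lparr>verts = V, edges = {\<psi> s ` e | s e. s \<in> S \<and> e \<in> edges F}\<rparr>"
  have \<kappa>: "\<kappa> (prod_encode (idx a, y)) = a" if "a \<in> verts F" for a y
    using that idx(1) by (simp add: \<kappa>_def)
  have can: "\<kappa> (\<psi> s a) = a" if "a \<in> verts F" for s a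
    using that by (simp add: \<psi>_def \<kappa>)
  have \<kappa>im: "\<kappa> ` \<psi> s ` e = e" if "e \<subseteq> verts F" for s e
    using that can by (auto simp: image_image subset_iff)
  have inj\<psi>: "inj_on (\<psi> s) (verts F)" for s
    by (rule inj_on_inverseI[where g = \<kappa>]) (simp add: can)
  have in_V: "\<psi> s a \<in> V" if "a \<in> verts F" for s a
    using that rs_value_less[OF m0] by (auto simp: \<psi>_def V_def)
  have determined: "s = s'" if s: "s \<in> S" "s' \<in> S" and A: "A \<subseteq> verts F" "d \<le> card A"
    and eq: "\<And>a. a \<in> A \<Longrightarrow> \<psi> s a = \<psi> s' a" for s s' A
  proof (rule rs_value_inj[OF m(1)])
    show "s \<in> {..<d} \<rightarrow>\<^sub>E {..<m}" "s' \<in> {..<d} \<rightarrow>\<^sub>E {..<m}" using s by (auto simp: S_def)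
    show "idx ` A \<subseteq> {..<m}" using A idx by auto
    show "d \<le> card (idx ` A)" using A idx(1) by (subst card_image) (auto intro: inj_on_subset)
    show "0 < d" using d by simp
    show "rs_value m d s j = rs_value m d s' j" if "j \<in> idx ` A" for j
      using that eq A by (auto simp: \<psi>_def subset_iff)
  qed
  have finV: "finite V" by (simp add: V_def)
  have "inj_on (\<lambda>(a, y). prod_encode (idx a, y)) (verts F \<times> {..<m})"
    using idx(1) by (auto simp: inj_on_def)
  hence "nverts G = card (verts F \<times> {..<m})"
    by (simp add: G_def V_def card_image del: card_cartesian_product)
  hence n: "nverts G = nverts F * m" by (simp add: card_cartesian_product)
  have "coloured r F (G, \<kappa>)"
    unfolding coloured_def prod.case rgraph_def homomorphism_def
  proof (intro conjI ballI)
    show "finite (verts G)" by (simp add: G_def finV)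
    show "\<kappa> \<in> verts G \<rightarrow> verts F" by (auto simp: G_def V_def \<kappa>)
    fix e assume "e \<in> edges G"
    then obtain s f where e: "e = \<psi> s ` f" "f \<in> edges F" by (auto simp: G_def)
    show "e \<subseteq> verts G" using in_V edge_F[OF e(2)] by (auto simp: G_def e)
    show "card e = r" unfolding e(1) using edge_F[OF e(2)] inj_on_subset[OF inj\<psi>]
      by (subst card_image) auto
    show "\<kappa> ` e \<in> edges F" using e edge_F by (simp add: \<kappa>im)
  qed
  moreover have pack: "packing F G \<kappa> (\<psi> ` S)"
    unfolding packing_def
  proof (intro conjI)
    show "\<psi> ` S \<subseteq> Embs F G"
    proof clarify
      fix s assume "s \<in> S"
      thus "\<psi> s \<in> Embs F G" using in_V inj\<psi>
        by (auto simp: Embs_def embedding_def homomorphism_def G_def) (simp add: \<psi>_def)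
    qed
    show "\<forall>\<theta>\<in>\<psi> ` S. \<forall>a\<in>verts F. \<kappa> (\<theta> a) = a" using can by auto
    have "\<psi> s = \<psi> s'" if "s \<in> S" "s' \<in> S" "e \<in> edges F" "e' \<in> edges F" "\<psi> s ` e = \<psi> s' ` e'" for s s' e e'
    proof -
      have "e = e'" using that edge_F \<kappa>im by metis
      have "\<psi> s a = \<psi> s' a" if "a \<in> e" for a
      proof -
        have "\<psi> s a \<in> \<psi> s' ` e'" using that \<open>\<psi> s ` e = \<psi> s' ` e'\<close> by auto
        then obtain b where b: "b \<in> e'" "\<psi> s a = \<psi> s' b" by auto
        thus ?thesis using can that edge_F \<open>e \<in> edges F\<close> \<open>e' \<in> edges F\<close> by (metis subsetD)
      qed
      thus ?thesis using determined[of s s' e] that edge_F d by auto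
    qed
    thus "\<forall>\<theta>\<in>\<psi> ` S. \<forall>\<theta>'\<in>\<psi> ` S. \<theta> \<noteq> \<theta>' \<longrightarrow> (`) \<theta> ` edges F \<inter> (`) \<theta>' ` edges F = {}"
      by blast
  qed
  have "uniformly_far r F (real m ^ (d - 1) / (real (nverts F) * real m) ^ (r - 1)) (G, \<kappa>)"
    unfolding uniformly_far_iff
  proof (intro exI conjI ballI)
    show "packing F G \<kappa> (\<psi> ` S)" by (rule pack)
    fix z assume "z \<in> verts G"
    then obtain a y where z: "z = prod_encode (idx a, y)" "a \<in> verts F" "y < m" by (auto simp: G_def V_def)
    let ?T = "{s \<in> S. rs_value m d s (idx a) = y}"
    have fS: "finite S" by (simp add: S_def finite_PiE)
    have "m ^ (d - 1) \<le> card ?T"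
      using card_rs_value_ge[OF m0 _ z(3), of d "idx a"] d by (simp add: S_def)
    also have "\<dots> = card (\<psi> ` ?T)"
      by (rule card_image[symmetric], rule inj_onI, rule determined[of _ _ "verts F"])
         (use d r_le_nverts_F in auto)
    also have "\<dots> \<le> card {\<theta> \<in> \<psi> ` S. z \<in> \<theta> ` verts F}"
      using z fS by (intro card_mono) (auto simp: \<psi>_def intro!: image_eqI[of _ _ a])
    finally have "real m ^ (d - 1) \<le> real (card {\<theta> \<in> \<psi> ` S. z \<in> \<theta> ` verts F})"
      by (metis of_nat_mono of_nat_power)
    thus "real m ^ (d - 1) / (real (nverts F) * real m) ^ (r - 1) * real (nverts G) ^ (r - 1)
       \<le> real (card {\<theta> \<in> \<psi> ` S. z \<in> \<theta> ` verts F})"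
      using m0 nverts_F_pos by (simp add: n)
  qed
  moreover have part: "card (part G \<kappa> a) = m" if "a \<in> verts F" for a
  proof -
    have "part G \<kappa> a = (\<lambda>y. prod_encode (idx a, y)) ` {..<m}"
      using that by (auto simp: part_def G_def V_def \<kappa>)
    thus ?thesis by (simp add: card_image inj_on_def)
  qed
  moreover have det: "x = x'" if "d < r" and e: "e \<in> edges G" "e' \<in> edges G" "x \<in> e" "x' \<in> e'"
    "\<kappa> x = \<kappa> x'" "e - {x} = e' - {x'}" for e e' x x'
  proof -
    obtain s f where f: "s \<in> S" "f \<in> edges F" "e = \<psi> s ` f" using e by (auto simp: G_def)
    obtain s' f' where f': "s' \<in> S" "f' \<in> edges F" "e' = \<psi> s' ` f'" using e by (auto simp: G_def)
    obtain a where a: "a \<in> f" "x = \<psi> s a" using e f by auto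
    obtain a' where a': "a' \<in> f'" "x' = \<psi> s' a'" using e f' by auto
    have aa: "a = a'" using e(5) can a a' f f' edge_F by (metis subsetD)
    have "s = s'"
    proof (rule determined[OF f(1) f'(1)])
      show "f - {a} \<subseteq> verts F" using edge_F f by auto
      show "d \<le> card (f - {a})" using \<open>d < r\<close> a edge_F(2)[OF f(2)] by simp
      fix b assume b: "b \<in> f - {a}"
      hence bF: "b \<in> verts F" using edge_F f by auto
      have aF: "a \<in> verts F" using edge_F f a by auto
      have "\<psi> s b \<noteq> \<psi> s a" using inj\<psi>[of s] b bF aF by (auto simp: inj_on_def)
      hence "\<psi> s b \<in> e' - {x'}" using b f a e(6) by auto
      then obtain b' where "b' \<in> f'" "\<psi> s b = \<psi> s' b'" using f' by auto
      thus "\<psi> s b = \<psi> s' b" using can bF f' edge_F by (metis subsetD)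
    qed
    thus ?thesis using a a' aa by simp
  qed
  ultimately have "uniform_host (real m ^ (d - 1) / (real (nverts F) * real m) ^ (r - 1)) G \<kappa>"
    using m0 by (force simp: uniform_host_def)
  thus ?thesis using part det unfolding determined_def by blast
qed

text \<open>For \<open>d = r\<close> the parameter does not depend on the prime, which is free to be large.\<close>

lemma dense_rs_graph:
  "\<exists>G \<kappa>. uniform_host (1 / real (nverts F) ^ (r - 1)) G \<kappa> \<and> (\<forall>a\<in>verts F. n \<le> card (part G \<kappa> a))"
proof -
  obtain m where m: "prime m" "max (nverts F) n < m" using bigger_prime by blast
  obtain G \<kappa> where G: "uniform_host (real m ^ (r - 1) / (real (nverts F) * real m) ^ (r - 1)) G \<kappa>"
    "\<And>a. a \<in> verts F \<Longrightarrow> card (part G \<kappa> a) = m"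
    using rs_graph_exists[of m r] m r_ge_2 by auto
  have "real m ^ (r - 1) / (real (nverts F) * real m) ^ (r - 1) = 1 / real (nverts F) ^ (r - 1)"
    using m nverts_F_pos by (simp add: power_mult_distrib)
  thus ?thesis using G m by (intro exI[of _ G] exI[of _ \<kappa>]) auto
qed

text \<open>For \<open>d = r - 1\<close> the parameter is \<open>1 / m\<close> up to a constant factor that depends on \<open>F\<close>; this factor
is absorbed, for large \<open>m\<close>, by weakening \<open>1 / m\<close> to \<open>1 / m\<^sup>2\<close>.\<close>

lemma sparse_rs_graph:
  "\<exists>m G \<kappa>. 2 \<le> m \<and> uniform_host (1 / real m ^ 2) G \<kappa> \<and> (\<forall>a\<in>verts F. card (part G \<kappa> a) = m) \<and> determined G \<kappa>"
proof -
  obtain m where m: "prime m" "max (nverts F) (nverts F ^ (r - 1)) < m" using bigger_prime by blast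
  have m2: "m \<ge> 2" using m(1) prime_ge_2_nat by blast
  have r1: "1 \<le> r - 1" "r - 1 \<le> r" "r - 1 < r" using r_ge_2 by auto
  obtain G \<kappa> where G: "uniform_host (real m ^ (r - 1 - 1) / (real (nverts F) * real m) ^ (r - 1)) G \<kappa>"
    "\<forall>a\<in>verts F. card (part G \<kappa> a) = m" "determined G \<kappa>"
    using rs_graph_exists[OF m(1) _ r1(1,2)] m(2) r1(3) by auto
  have "real m ^ (r - 1) = real m ^ (r - 1 - 1) * real m"
  proof -
    obtain q where "r = 2 + q" using le_Suc_ex[OF r_ge_2] by auto
    thus ?thesis by simp
  qed
  hence "real m ^ (r - 1 - 1) / (real (nverts F) * real m) ^ (r - 1) = 1 / (real (nverts F) ^ (r - 1) * real m)"
    using m2 nverts_F_pos by (simp add: power_mult_distrib)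
  moreover have "1 / (real m * real m) \<le> 1 / (real (nverts F) ^ (r - 1) * real m)"
    using m nverts_F_pos m2
    by (intro divide_left_mono mult_right_mono) (auto simp flip: of_nat_power)
  ultimately have "uniform_host (1 / real m ^ 2) G \<kappa>" using uniform_host_mono[OF G(1)] by (simp add: power2_eq_square)
  thus ?thesis using G m2 by blast
qed

text \<open>Edges are chosen one after the other, each containing a vertex not covered before; this is
possible \<open>N + 1\<close> times, because \<open>N\<close> edges cover at most \<open>r * N\<close> vertices. A homomorphism is
determined by its values off the \<open>N + 1\<close> new vertices, since the image of each new vertex
is determined by the images of the other vertices of its edge.\<close>

lemma hom_density_le_if_determined:
  assumes G: "coloured r F (G, \<kappa>)" "\<And>a. a \<in> verts F \<Longrightarrow> card (part G \<kappa> a) = m" "0 < m" "determined G \<kappa>"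
    and H: "coloured r F (H, \<sigma>)" and long: "r * N < nverts (del_isolated H)"
  shows "hom_density H \<sigma> G \<kappa> \<le> 1 / real m ^ (N + 1)"
proof -
  let ?Hom = "Homs_col H \<sigma> G \<kappa>" and ?A = "verts (del_isolated H)"
  have rH: "rgraph r H" and finH: "finite (verts H)" and hom: "homomorphism H F \<sigma>"
    using H by (auto simp: coloured_def rgraph_def)
  have finG: "finite (verts G)" using G by (auto simp: coloured_def rgraph_def)
  have eH: "e \<subseteq> verts H" "card e = r" if "e \<in> edges H" for e using rH that by (auto simp: rgraph_def)
  \<comment> \<open>Homomorphisms that agree on \<open>U\<close> outside of the set \<open>X\<close> of new vertices agree on \<open>U\<close>.\<close>
  define forces where "forces U X \<longleftrightarrow>
      (\<forall>\<phi>\<in>?Hom. \<forall>\<theta>\<in>?Hom. (\<forall>y\<in>U - X. \<phi> y = \<theta> y) \<longrightarrow> (\<forall>y\<in>U. \<phi> y = \<theta> y))" for U X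
  have ex: "\<exists>X U. X \<subseteq> U \<and> U \<subseteq> verts H \<and> card X = j \<and> card U \<le> r * j \<and> forces U X"
    if "j \<le> N + 1" for j
    using that
  proof (induction j)
    case 0
    show ?case by (rule exI[of _ "{}"], rule exI[of _ "{}"]) (auto simp: forces_def)
  next
    case (Suc j)
    then obtain X U where XU: "X \<subseteq> U" "U \<subseteq> verts H" "card X = j" "card U \<le> r * j"
      and "forces U X"
      by auto
    hence det: "\<forall>y\<in>U. \<phi> y = \<theta> y"
      if "\<phi> \<in> ?Hom" "\<theta> \<in> ?Hom" "\<forall>y\<in>U - X. \<phi> y = \<theta> y" for \<phi> \<theta>
      using that unfolding forces_def by blast
    have finU: "finite U" by (rule finite_subset[OF XU(2) finH])
    have finX: "finite X" by (rule finite_subset[OF XU(1) finU])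
    have "r * j \<le> r * N" using Suc.prems by simp
    hence "card U < card ?A" using XU(4) long by linarith
    hence "\<not> ?A \<subseteq> U" using card_mono[OF finU, of ?A] by linarith
    then obtain x e where x: "x \<notin> U" "e \<in> edges H" "x \<in> e"
      by (auto simp: verts_del_isolated[OF rH])
    show ?case
      unfolding forces_def
    proof (intro exI conjI ballI impI)
      show "insert x X \<subseteq> U \<union> e" "U \<union> e \<subseteq> verts H" using XU x eH by auto
      show "card (insert x X) = Suc j" using XU x finX by (subst card_insert_disjoint) auto
      show "card (U \<union> e) \<le> r * Suc j" using card_Un_le[of U e] eH(2)[OF x(2)] XU by simp
      fix \<phi> \<theta> y
      assume \<phi>: "\<phi> \<in> ?Hom" and \<theta>: "\<theta> \<in> ?Hom" and eq: "\<forall>y\<in>U \<union> e - insert x X. \<phi> y = \<theta> y" and y: "y \<in> U \<union> e"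
      have eqU: "\<forall>y\<in>U. \<phi> y = \<theta> y" using eq x by (intro det[OF \<phi> \<theta>]) auto
      have eqe: "\<phi> y = \<theta> y" if "y \<in> e - {x}" for y
        using eqU eq that XU by (cases "y \<in> U") auto
      have kap: "\<kappa> (\<phi> y) = \<sigma> y" if "\<phi> \<in> ?Hom" "y \<in> e" for \<phi> y
        using that eH(1)[OF x(2)] by (auto simp: Homs_col_def part_def PiE_def Pi_def)
      have inj: "inj_on \<phi> e" if "\<phi> \<in> ?Hom" for \<phi>
      proof (rule inj_onI)
        fix y z assume "y \<in> e" "z \<in> e" "\<phi> y = \<phi> z"
        hence "\<sigma> y = \<sigma> z" using kap that by metis
        thus "y = z" using colouring_inj_on_edge[OF H x(2)] \<open>y \<in> e\<close> \<open>z \<in> e\<close> by (auto simp: inj_on_def)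
      qed
      have del: "\<phi> ` e - {\<phi> x} = \<phi> ` (e - {x})" if "\<phi> \<in> ?Hom" for \<phi>
        using inj_on_image_set_diff[OF inj[OF that], of e "{x}"] x(3) by simp
      have "\<phi> ` e - {\<phi> x} = \<theta> ` e - {\<theta> x}"
        unfolding del[OF \<phi>] del[OF \<theta>] using eqe by (intro image_cong) auto
      moreover have "\<phi> ` e \<in> edges G" "\<theta> ` e \<in> edges G" using \<phi> \<theta> x by (auto simp: Homs_col_def)
      moreover have "\<kappa> (\<phi> x) = \<kappa> (\<theta> x)" using kap \<phi> \<theta> x by simp
      ultimately have "\<phi> x = \<theta> x"
        using G(4)[unfolded determined_def, rule_format, of "\<phi> ` e" "\<theta> ` e" "\<phi> x" "\<theta> x"] x(3) by simp
      thus "\<phi> y = \<theta> y" using y eqU eqe by auto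
    qed
  qed
  from ex[of "N + 1"] obtain X U where XU: "X \<subseteq> U" "U \<subseteq> verts H" "card X = N + 1"
    and "forces U X" by auto
  hence det: "\<forall>y\<in>U. \<phi> y = \<theta> y"
    if "\<phi> \<in> ?Hom" "\<theta> \<in> ?Hom" "\<forall>y\<in>U - X. \<phi> y = \<theta> y" for \<phi> \<theta>
    using that unfolding forces_def by blast
  have parts: "card (part G \<kappa> (\<sigma> x)) = m" if "x \<in> verts H" for x
    using G(2) hom that by (auto simp: homomorphism_def)
  have "card ?Hom \<le> card (\<Pi>\<^sub>E x\<in>verts H - X. part G \<kappa> (\<sigma> x))"
  proof (rule card_inj_on_le)
    show "inj_on (\<lambda>\<phi>. restrict \<phi> (verts H - X)) ?Hom"
    proof (rule inj_onI)
      fix \<phi> \<theta> assume *: "\<phi> \<in> ?Hom" "\<theta> \<in> ?Hom" "restrict \<phi> (verts H - X) = restrict \<theta> (verts H - X)"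
      have eq: "\<phi> x = \<theta> x" if "x \<in> verts H" "x \<notin> X" for x
        using fun_cong[OF *(3), of x] that by simp
      have "\<forall>y\<in>U. \<phi> y = \<theta> y" using eq XU by (intro det[OF *(1,2)]) auto
      hence "\<phi> x = \<theta> x" if "x \<in> verts H" for x using eq that XU by (cases "x \<in> X") auto
      thus "\<phi> = \<theta>" using * by (intro PiE_ext[of \<phi> "verts H" "\<lambda>x. part G \<kappa> (\<sigma> x)" \<theta>]) (auto simp: Homs_col_def)
    qed
    show "(\<lambda>\<phi>. restrict \<phi> (verts H - X)) ` ?Hom \<subseteq> (\<Pi>\<^sub>E x\<in>verts H - X. part G \<kappa> (\<sigma> x))"
      by (auto simp: Homs_col_def)
  qed (use finH finG in \<open>auto intro!: finite_PiE\<close>)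
  also have "\<dots> = m ^ (nverts H - (N + 1))"
  proof -
    have "finite X" by (rule finite_subset[OF _ finH]) (use XU in auto)
    thus ?thesis using XU finH parts by (simp add: card_PiE card_Diff_subset)
  qed
  finally have "card ?Hom * m ^ (N + 1) \<le> m ^ (nverts H - (N + 1)) * m ^ (N + 1)"
    by (rule mult_right_mono) simp
  also have "\<dots> = m ^ (nverts H - (N + 1) + (N + 1))" by (rule power_add[symmetric])
  also have "nverts H - (N + 1) + (N + 1) = nverts H"
    using XU card_mono[OF finH subset_trans[OF XU(1,2)]] by simp
  finally have "real (card ?Hom) * real m ^ (N + 1) \<le> real m ^ nverts H"
    by (metis of_nat_mono of_nat_mult of_nat_power)
  moreover have "hom_density H \<sigma> G \<kappa> = real (card ?Hom) / real m ^ nverts H"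
    by (simp add: hom_density_def parts)
  ultimately have "hom_density H \<sigma> G \<kappa> \<le> (real m ^ nverts H / real m ^ (N + 1)) / real m ^ nverts H"
    using G(3) by (auto intro!: divide_right_mono simp: pos_le_divide_eq)
  thus ?thesis using G(3) by simp
qed

end

section \<open>Coloured graphs of vanishing density\<close>

text \<open>Take the last power of \<open>b\<close> that is not below \<open>a\<close>: the next power, and so also the square, is.\<close>

lemma balancing_power:
  fixes a b :: real
  assumes "0 < a" "a \<le> b" "b < 1"
  shows "\<exists>l\<ge>1. a \<le> b ^ l \<and> (b ^ l)\<^sup>2 \<le> a"
proof -
  define k where "k = (LEAST k. b ^ k < a)"
  have "\<exists>k. b ^ k < a" using assms by (intro real_arch_pow_inv) auto
  hence k: "b ^ k < a" unfolding k_def by (rule LeastI_ex)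
  have nk: "a \<le> b ^ j" if "j < k" for j using not_less_Least[of j "\<lambda>k. b ^ k < a"] that by (auto simp: k_def)
  have "k \<noteq> 0" using k assms by (intro notI) auto
  moreover have "k \<noteq> 1" using k assms by (intro notI) auto
  ultimately have k2: "2 \<le> k" by linarith
  have "(b ^ (k - 1))\<^sup>2 = b ^ ((k - 1) * 2)" by (simp only: power_mult)
  also have "\<dots> \<le> b ^ k" using assms k2 by (intro power_decreasing) auto
  finally show ?thesis using nk[of "k - 1"] k k2 by (intro exI[of _ "k - 1"]) auto
qed

context pattern
begin

text \<open>Every polynomial lower bound for the density in terms of the parameter fails. Parameters
at most \<open>1 / 2\<close> make arbitrary constant factors negligible against powers of \<open>\<epsilon>\<close>.\<close>

definition vanishing :: "'a hgraph \<Rightarrow> ('a \<Rightarrow> 'f) \<Rightarrow> bool" where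
  "vanishing H \<sigma> \<longleftrightarrow> (\<forall>K::nat. \<exists>\<epsilon> G \<kappa>. 0 < \<epsilon> \<and> \<epsilon> \<le> 1 / 2 \<and> uniform_host \<epsilon> G \<kappa> \<and> hom_density H \<sigma> G \<kappa> \<le> \<epsilon> ^ K)"

text \<open>Every part of a uniformly \<open>\<epsilon>\<close>-far host with \<open>n\<close> vertices has at least \<open>\<epsilon> * n / v(F)\<close>
vertices. So replacing powers of \<open>n\<close> by the sizes of the parts loses only a constant factor and a fixed power of \<open>\<epsilon>\<close>, and this is
compensated by a larger exponent in the failure of abundance.\<close>

lemma vanishing_if_not_abundant_col:
  assumes H: "coloured r F (H, \<sigma>)" and "\<not> abundant_col r F (H, \<sigma>)"
  shows "vanishing H \<sigma>"
  unfolding vanishing_def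
proof
  fix K :: nat
  define v where "v = nverts H"
  define f where "f = real (nverts F)"
  have f: "f > 0" using nverts_F_pos by (simp add: f_def)
  \<comment> \<open>The factor \<open>2 * f ^ v\<close> pays for the non-injective maps and for the sizes of the parts, the
    factor \<open>2 ^ K\<close> for replacing \<open>\<epsilon>\<close> by \<open>\<epsilon> / 2\<close>, which guarantees a parameter at most \<open>1 / 2\<close>.\<close>
  define c' where "c' = 1 / (2 * f ^ v * 2 ^ K)"
  define C' where "C' = real (K + v + 1)"
  have c': "c' > 0" using f by (simp add: c'_def)
  have finH: "finite (verts H)" and hom: "homomorphism H F \<sigma>" using H by (auto simp: coloured_def rgraph_def)
  have "\<not> (\<forall>\<epsilon>::real. 0 < \<epsilon> \<and> \<epsilon> \<le> 1 \<longrightarrow>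
        (\<exists>n\<^sub>0::nat. \<forall>(G::nat hgraph) \<kappa>.
           coloured r F (G, \<kappa>) \<and> nverts G \<ge> n\<^sub>0 \<and> uniformly_far r F \<epsilon> (G, \<kappa>) \<longrightarrow>
           real (Emb_col (H, \<sigma>) (G, \<kappa>)) \<ge> c' * \<epsilon> powr C' * real (nverts G) ^ nverts H))"
    using assms(2) c' unfolding abundant_col_def prod.case by (metis C'_def of_nat_0_less_iff zero_less_Suc Suc_eq_plus1)
  then obtain \<epsilon> :: real where \<epsilon>: "0 < \<epsilon>" "\<epsilon> \<le> 1" and
    ex: "\<And>n\<^sub>0::nat. \<exists>(G::nat hgraph) \<kappa>.
           coloured r F (G, \<kappa>) \<and> nverts G \<ge> n\<^sub>0 \<and> uniformly_far r F \<epsilon> (G, \<kappa>) \<and>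
           real (Emb_col (H, \<sigma>) (G, \<kappa>)) < c' * \<epsilon> powr C' * real (nverts G) ^ nverts H"
    by (metis not_le)
  have powr: "\<epsilon> powr C' = \<epsilon> ^ (K + v + 1)" using \<epsilon> by (simp only: C'_def powr_realpow)
  define y where "y = c' * \<epsilon> powr C'"
  have y: "y > 0" using c' \<epsilon> by (simp add: y_def)
  obtain n0 :: nat where n0: "real v ^ 2 / y < real n0" using reals_Archimedean2 by blast
  obtain G :: "nat hgraph" and \<kappa> where G: "coloured r F (G, \<kappa>)" "nverts G \<ge> max n0 1" "uniformly_far r F \<epsilon> (G, \<kappa>)"
    "real (Emb_col (H, \<sigma>) (G, \<kappa>)) < y * real (nverts G) ^ v"
    using ex[of "max n0 1", folded y_def v_def] by blast
  let ?n = "real (nverts G)"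
  have n: "?n > 0" "real n0 \<le> ?n" using G(2) by auto
  have finG: "finite (verts G)" using G by (auto simp: coloured_def rgraph_def)
  have part: "\<epsilon> * ?n / f \<le> real (card (part G \<kappa> a))" if "a \<in> verts F" for a
    using uniformly_far_part_ge[OF G(3) finG that] by (simp add: f_def)
  have pos: "0 < \<epsilon> * ?n / f" using \<epsilon> n f by simp
  have ne: "part G \<kappa> a \<noteq> {}" if "a \<in> verts F" for a
  proof
    assume "part G \<kappa> a = {}"
    thus False using part[OF that] pos by simp
  qed
  have few: "real v ^ 2 * ?n ^ (v - 1) \<le> y * ?n ^ v"
  proof (cases v)
    case 0
    thus ?thesis using y by simp
  next
    case (Suc w)
    have "real v ^ 2 \<le> real n0 * y" using n0 y by (simp add: pos_divide_less_eq)
    also have "\<dots> \<le> ?n * y" using n y by (intro mult_right_mono) auto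
    finally have "real v ^ 2 \<le> y * ?n" by (simp add: mult.commute)
    thus ?thesis using Suc n by (simp add: mult_right_mono)
  qed
  have "real (card (Homs_col H \<sigma> G \<kappa>)) \<le> real (Emb_col (H, \<sigma>) (G, \<kappa>)) + real v ^ 2 * ?n ^ (v - 1)"
    using of_nat_mono[where 'a = real, OF card_Homs_col_le_Emb_col[OF finH finG, of \<sigma> \<kappa>]] by (simp add: v_def)
  hence hom_le: "real (card (Homs_col H \<sigma> G \<kappa>)) \<le> 2 * y * ?n ^ v" using few G(4) by linarith
  have "(\<epsilon> * ?n / f) ^ v = (\<Prod>x\<in>verts H. \<epsilon> * ?n / f)" by (simp add: v_def)
  also have "\<dots> \<le> (\<Prod>x\<in>verts H. real (card (part G \<kappa> (\<sigma> x))))"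
    using hom pos by (intro prod_mono conjI part) (auto simp: homomorphism_def)
  finally have "hom_density H \<sigma> G \<kappa> \<le> (2 * y * ?n ^ v) / (\<epsilon> * ?n / f) ^ v"
    unfolding hom_density_def using hom_le pos y n by (intro frac_le zero_less_power) auto
  also have "\<dots> = \<epsilon> ^ (K + 1) / 2 ^ K"
    using n \<epsilon> f by (simp add: y_def powr c'_def field_simps power_add)
  also have "\<dots> \<le> \<epsilon> ^ K / 2 ^ K"
    using \<epsilon> by (intro divide_right_mono power_decreasing) auto
  finally have "hom_density H \<sigma> G \<kappa> \<le> (\<epsilon> / 2) ^ K" by (simp add: power_divide)
  moreover have "uniform_host (\<epsilon> / 2) G \<kappa>"
    using G ne \<epsilon> uniform_host_mono[of \<epsilon> G \<kappa> "\<epsilon> / 2"] by (simp add: uniform_host_def)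
  ultimately show "\<exists>\<epsilon> G \<kappa>. 0 < \<epsilon> \<and> \<epsilon> \<le> 1 / 2 \<and> uniform_host \<epsilon> G \<kappa> \<and> hom_density H \<sigma> G \<kappa> \<le> \<epsilon> ^ K"
    using \<epsilon> by (intro exI[of _ "\<epsilon> / 2"] exI[of _ G] exI[of _ \<kappa>]) auto
qed

text \<open>Replacing one host by a power, one may assume that the square of either parameter is at most
the other parameter. Then the cube of either is at most their product, which is the parameter of
the product host. This is where the exponent \<open>3 * K\<close> comes from.\<close>

lemma combine_uniform_hosts:
  assumes G: "uniform_host a G \<kappa>" "0 < a" "a \<le> 1 / 2" and G': "uniform_host b G' \<kappa>'" "0 < b" "b \<le> 1 / 2"
  shows "\<exists>\<epsilon> P \<pi>. 0 < \<epsilon> \<and> \<epsilon> \<le> 1 / 2 \<and> uniform_host \<epsilon> P \<pi> \<and>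
    (\<forall>(H :: 'a hgraph) \<sigma> K. rgraph r H \<and> (hom_density H \<sigma> G \<kappa> \<le> a ^ (3 * K) \<or> hom_density H \<sigma> G' \<kappa>' \<le> b ^ (3 * K)) \<longrightarrow>
       hom_density H \<sigma> P \<pi> \<le> \<epsilon> ^ K)"
proof -
  have wlog: "\<exists>\<epsilon> P \<pi>. 0 < \<epsilon> \<and> \<epsilon> \<le> 1 / 2 \<and> uniform_host \<epsilon> P \<pi> \<and>
    (\<forall>(H :: 'a hgraph) \<sigma> K. rgraph r H \<and> (hom_density H \<sigma> G \<kappa> \<le> a ^ (3 * K) \<or> hom_density H \<sigma> G' \<kappa>' \<le> b ^ (3 * K)) \<longrightarrow>
       hom_density H \<sigma> P \<pi> \<le> \<epsilon> ^ K)"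
    if G: "uniform_host a G \<kappa>" "0 < a" and G': "uniform_host b G' \<kappa>'" "0 < b" "b \<le> 1 / 2" and ab: "a \<le> b"
    for a b :: real and G G' \<kappa> \<kappa>'
  proof -
    obtain l where l: "l \<ge> 1" "a \<le> b ^ l" "(b ^ l)\<^sup>2 \<le> a"
      using balancing_power[of a b] G G' ab by auto
    obtain G'' \<kappa>'' where G'': "uniform_host (b ^ l) G'' \<kappa>''"
      and d: "\<And>(H :: 'a hgraph) \<sigma>. rgraph r H \<Longrightarrow> hom_density H \<sigma> G'' \<kappa>'' = hom_density H \<sigma> G' \<kappa>' ^ l"
      using uniform_host_power[OF G'(1) _ l(1), where ?'a = 'a] G' by auto
    define B where "B = b ^ l"
    have B: "0 < B" "B \<le> 1 / 2" "a \<le> B" "B\<^sup>2 \<le> a"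
      using l G' power_decreasing[of 1 l b] by (auto simp: B_def)
    have a3: "a ^ 3 \<le> a * B" "B ^ 3 \<le> a * B"
    proof -
      have "a * a \<le> 1 * B" using B that by (intro mult_mono) auto
      thus "a ^ 3 \<le> a * B" using that(2) by (simp add: power3_eq_cube mult_le_cancel_left)
      show "B ^ 3 \<le> a * B" using B by (simp add: power3_eq_cube power2_eq_square)
    qed
    have fin: "finite (verts G)" "finite (verts G'')"
      using G G'' by (auto simp: uniform_host_def coloured_def rgraph_def)
    let ?P = "fprod G \<kappa> G'' \<kappa>''"
    have "hom_density H \<sigma> ?P (\<kappa> \<circ> proj1) \<le> (a * B) ^ K"
      if H: "rgraph r H" and "hom_density H \<sigma> G \<kappa> \<le> a ^ (3 * K) \<or> hom_density H \<sigma> G' \<kappa>' \<le> b ^ (3 * K)"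
      for H :: "'a hgraph" and \<sigma> K
    proof -
      have e: "hom_density H \<sigma> ?P (\<kappa> \<circ> proj1) = hom_density H \<sigma> G \<kappa> * hom_density H \<sigma> G' \<kappa>' ^ l"
        using H by (subst hom_density_fprod) (auto simp: d rgraph_def)
      have le1: "hom_density H \<sigma> G \<kappa> \<le> 1" "hom_density H \<sigma> G' \<kappa>' ^ l \<le> 1"
        using hom_density_le_1[OF finite_verts[OF H]] fin d[OF H, symmetric] by auto
      from that(2) show ?thesis
      proof
        assume *: "hom_density H \<sigma> G \<kappa> \<le> a ^ (3 * K)"
        have "hom_density H \<sigma> ?P (\<kappa> \<circ> proj1) \<le> hom_density H \<sigma> G \<kappa> * 1"
          unfolding e by (intro mult_left_mono le1 hom_density_nonneg)
        also have "\<dots> \<le> (a ^ 3) ^ K" using * by (simp add: power_mult)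
        also have "\<dots> \<le> (a * B) ^ K" using a3 G by (intro power_mono) auto
        finally show ?thesis .
      next
        assume *: "hom_density H \<sigma> G' \<kappa>' \<le> b ^ (3 * K)"
        have "hom_density H \<sigma> ?P (\<kappa> \<circ> proj1) \<le> 1 * hom_density H \<sigma> G' \<kappa>' ^ l"
          unfolding e by (intro mult_right_mono le1) (simp add: hom_density_nonneg)
        also have "\<dots> \<le> (b ^ (3 * K)) ^ l" using * by (simp add: power_mono hom_density_nonneg)
        also have "\<dots> = (B ^ 3) ^ K" by (simp add: B_def mult.commute flip: power_mult) (simp add: mult.left_commute mult.commute)
        also have "\<dots> \<le> (a * B) ^ K" using a3 B by (intro power_mono) auto
        finally show ?thesis .
      qed
    qed
    moreover have "uniform_host (a * B) ?P (\<kappa> \<circ> proj1)"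
      using uniform_host_fprod[OF G(1) G''] G B by (simp add: B_def)
    moreover have "0 < a * B" "a * B \<le> 1 / 2"
      using B G mult_mono[of a "1/2" B "1"] by auto
    ultimately show ?thesis by blast
  qed
  show ?thesis
  proof (cases "a \<le> b")
    case True
    thus ?thesis using wlog[OF G(1,2) G'] by blast
  next
    case False
    thus ?thesis using wlog[OF G'(1,2) G] by (metis less_imp_le not_le)
  qed
qed

lemma simultaneously_vanishing:
  fixes T :: "('a hgraph \<times> ('a \<Rightarrow> 'f)) set"
  assumes "finite T" "\<And>H \<sigma>. (H, \<sigma>) \<in> T \<Longrightarrow> rgraph r H \<and> vanishing H \<sigma>"
  shows "\<exists>\<epsilon> G \<kappa>. 0 < \<epsilon> \<and> \<epsilon> \<le> 1 / 2 \<and> uniform_host \<epsilon> G \<kappa> \<and> (\<forall>(H, \<sigma>)\<in>T. hom_density H \<sigma> G \<kappa> \<le> \<epsilon> ^ K)"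
  using assms
proof (induction T arbitrary: K rule: finite_induct)
  case empty
  obtain G \<kappa> where "uniform_host (1 / real (nverts F) ^ (r - 1)) G \<kappa>" using dense_rs_graph by blast
  moreover define \<epsilon> where "\<epsilon> = min (1 / 2) (1 / real (nverts F) ^ (r - 1))"
  ultimately have "uniform_host \<epsilon> G \<kappa>" using uniform_host_mono by simp
  moreover have "0 < \<epsilon>" "\<epsilon> \<le> 1 / 2" using nverts_F_pos by (simp_all add: \<epsilon>_def)
  ultimately show ?case by blast
next
  case (insert t T)
  obtain H0 \<sigma>0 where t: "t = (H0, \<sigma>0)" by (cases t)
  obtain a G \<kappa> where G: "uniform_host a G \<kappa>" "0 < a" "a \<le> 1 / 2" "\<forall>(H, \<sigma>)\<in>T. hom_density H \<sigma> G \<kappa> \<le> a ^ (3 * K)"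
    using insert.IH[of "3 * K"] insert.prems by blast
  obtain b G' \<kappa>' where G': "uniform_host b G' \<kappa>'" "0 < b" "b \<le> 1 / 2" "hom_density H0 \<sigma>0 G' \<kappa>' \<le> b ^ (3 * K)"
    using insert.prems[of H0 \<sigma>0] t unfolding vanishing_def by blast
  obtain \<epsilon> P \<pi> where P: "0 < \<epsilon>" "\<epsilon> \<le> 1 / 2" "uniform_host \<epsilon> P \<pi>"
    "\<And>(H :: 'a hgraph) \<sigma>. rgraph r H \<Longrightarrow> hom_density H \<sigma> G \<kappa> \<le> a ^ (3 * K) \<or> hom_density H \<sigma> G' \<kappa>' \<le> b ^ (3 * K) \<Longrightarrow>
       hom_density H \<sigma> P \<pi> \<le> \<epsilon> ^ K"
    using combine_uniform_hosts[OF G(1-3) G'(1-3), where ?'a = 'a] by blast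
  have "hom_density H \<sigma> P \<pi> \<le> \<epsilon> ^ K" if "(H, \<sigma>) \<in> insert t T" for H \<sigma>
    using that insert.prems[OF that] P(4)[of H \<sigma>] G(4) G'(4) t by auto
  thus ?case using P by blast
qed

section \<open>One host that is sparse for every unwanted coloured graph\<close>

text \<open>Up to isomorphism and isolated vertices there are finitely many coloured graphs with a
bounded number of non-isolated vertices.\<close>

lemma small_representatives:
  "\<exists>I :: (nat hgraph \<times> (nat \<Rightarrow> 'f)) set. finite I \<and> (\<forall>X\<in>I. coloured r F X) \<and>
     (\<forall>(H :: 'a hgraph) \<sigma>. coloured r F (H, \<sigma>) \<and> nverts (del_isolated H) \<le> M \<longrightarrow>
        (\<exists>(H', \<sigma>')\<in>I. \<forall>\<epsilon> G \<kappa>. uniform_host \<epsilon> G \<kappa> \<longrightarrow> hom_density H \<sigma> G \<kappa> = hom_density H' \<sigma>' G \<kappa>))"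
proof -
  define I0 where "I0 = (\<Union>v\<le>M. (\<lambda>(E, \<sigma>). (\<lparr>verts = {..<v}, edges = E\<rparr>, \<sigma>)) `
     (Pow (Pow {..<v}) \<times> ({..<v} \<rightarrow>\<^sub>E verts F)))"
  define I where "I = {X \<in> I0. coloured r F X}"
  have "finite I0" unfolding I0_def by (intro finite_UN_I finite_imageI finite_cartesian_product) (auto intro!: finite_PiE)
  hence "finite I" by (simp add: I_def)
  moreover have "\<exists>(H', \<sigma>')\<in>I. \<forall>\<epsilon> G \<kappa>. uniform_host \<epsilon> G \<kappa> \<longrightarrow> hom_density H \<sigma> G \<kappa> = hom_density H' \<sigma>' G \<kappa>"
    if H: "coloured r F (H, \<sigma>)" and M: "nverts (del_isolated H) \<le> M" for H :: "'a hgraph" and \<sigma>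
  proof -
    let ?D = "del_isolated H"
    define v where "v = nverts ?D"
    have rH: "rgraph r H" and hom: "homomorphism H F \<sigma>" using H by (auto simp: coloured_def)
    have sub: "verts ?D \<subseteq> verts H" by (auto simp: del_isolated_def)
    have fin: "finite (verts ?D)" using finite_subset[OF sub finite_verts[OF rH]] .
    have eD: "e \<subseteq> verts ?D" "card e = r" "\<sigma> ` e \<in> edges F" if "e \<in> edges H" for e
      using that rH hom by (auto simp: verts_del_isolated[OF rH] rgraph_def homomorphism_def)
    obtain \<beta> where bij: "bij_betw \<beta> (verts ?D) {0..<v}"
      using ex_bij_betw_finite_nat[OF fin] by (auto simp: v_def)
    hence \<beta>: "inj_on \<beta> (verts ?D)" "\<beta> ` verts ?D = {..<v}"
      by (auto simp: bij_betw_def)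
    define H' where "H' = \<lparr>verts = {..<v}, edges = (`) \<beta> ` edges H\<rparr>"
    define \<sigma>' where "\<sigma>' = (\<lambda>i\<in>{..<v}. \<sigma> (inv_into (verts ?D) \<beta> i))"
    have \<sigma>': "\<sigma>' (\<beta> x) = \<sigma> x" if "x \<in> verts ?D" for x
      using \<beta> that by (auto simp: \<sigma>'_def)
    have \<sigma>'V: "\<sigma>' i \<in> verts F" if "i < v" for i
    proof -
      have "i \<in> \<beta> ` verts ?D" using that by (simp add: \<beta>(2))
      then obtain x where "x \<in> verts ?D" "i = \<beta> x" by blast
      thus ?thesis using \<sigma>' sub hom by (auto simp: homomorphism_def)
    qed
    have edge: "\<beta> ` e \<subseteq> {..<v}" "card (\<beta> ` e) = r" "\<sigma>' ` \<beta> ` e = \<sigma> ` e" if "e \<in> edges H" for e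
    proof -
      show "\<beta> ` e \<subseteq> {..<v}" using eD[OF that] \<beta>(2) by blast
      show "card (\<beta> ` e) = r" using eD[OF that] inj_on_subset[OF \<beta>(1)] by (simp add: card_image)
      show "\<sigma>' ` \<beta> ` e = \<sigma> ` e"
        unfolding image_image using eD(1)[OF that] \<sigma>' by (intro image_cong) auto
    qed
    have "coloured r F (H', \<sigma>')"
      using edge \<sigma>'V eD by (auto simp: coloured_def rgraph_def homomorphism_def H'_def)
    moreover have "(H', \<sigma>') \<in> I0"
      unfolding I0_def
    proof (intro UN_I[of v] image_eqI[of _ _ "((`) \<beta> ` edges H, \<sigma>')"] SigmaI)
      show "v \<in> {..M}" using M by (simp add: v_def)
      show "(`) \<beta> ` edges H \<in> Pow (Pow {..<v})" using edge by auto
      show "\<sigma>' \<in> {..<v} \<rightarrow>\<^sub>E verts F" using \<sigma>'V by (auto simp: \<sigma>'_def)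
    qed (simp add: H'_def)
    moreover have "hom_density H \<sigma> G \<kappa> = hom_density H' \<sigma>' G \<kappa>" if G: "uniform_host \<epsilon> G \<kappa>" for \<epsilon> G \<kappa>
    proof -
      have "hom_density H \<sigma> G \<kappa> = hom_density ?D \<sigma> G \<kappa>"
        using G hom by (intro hom_density_del_isolated[OF rH, symmetric])
          (auto simp: uniform_host_def coloured_def rgraph_def homomorphism_def)
      also have "\<dots> = hom_density H' \<sigma>' G \<kappa>"
        unfolding H'_def using hom_density_iso[OF bij, of \<sigma>' \<sigma> G \<kappa>] eD(1) \<sigma>' by (simp add: lessThan_atLeast0)
      finally show ?thesis .
    qed
    ultimately show ?thesis by (auto simp: I_def)
  qed
  ultimately show ?thesis by (intro exI[of _ I]) (auto simp: I_def)
qed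

lemma vanishing_at_one_host:
  "\<exists>\<epsilon> G \<kappa>. 0 < \<epsilon> \<and> \<epsilon> \<le> 1 / 2 \<and> uniform_host \<epsilon> G \<kappa> \<and>
     (\<forall>(H :: 'a hgraph) \<sigma>. coloured r F (H, \<sigma>) \<and> vanishing H \<sigma> \<and> nverts (del_isolated H) \<le> M \<longrightarrow>
        hom_density H \<sigma> G \<kappa> \<le> \<epsilon> ^ K)"
proof -
  obtain I :: "(nat hgraph \<times> (nat \<Rightarrow> 'f)) set" where I: "finite I" "\<And>X. X \<in> I \<Longrightarrow> coloured r F X"
    and rep: "\<And>(H :: 'a hgraph) \<sigma>. coloured r F (H, \<sigma>) \<Longrightarrow> nverts (del_isolated H) \<le> M \<Longrightarrow>
        \<exists>(H', \<sigma>')\<in>I. \<forall>\<epsilon> G \<kappa>. uniform_host \<epsilon> G \<kappa> \<longrightarrow> hom_density H \<sigma> G \<kappa> = hom_density H' \<sigma>' G \<kappa>"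
    using small_representatives[where ?'a = 'a, of M] by blast
  define T where "T = {(H, \<sigma>) \<in> I. vanishing H \<sigma>}"
  have T: "finite T" "\<And>H \<sigma>. (H, \<sigma>) \<in> T \<Longrightarrow> rgraph r H \<and> vanishing H \<sigma>"
    using I finite_subset[of T I] by (auto simp: T_def coloured_def)
  obtain \<epsilon> G \<kappa> where G: "0 < \<epsilon>" "\<epsilon> \<le> 1 / 2" "uniform_host \<epsilon> G \<kappa>" "\<And>H \<sigma>. (H, \<sigma>) \<in> T \<Longrightarrow> hom_density H \<sigma> G \<kappa> \<le> \<epsilon> ^ K"
    using simultaneously_vanishing[OF T, of K] by blast
  have "hom_density H \<sigma> G \<kappa> \<le> \<epsilon> ^ K"
    if H: "coloured r F (H, \<sigma>)" "vanishing H \<sigma>" "nverts (del_isolated H) \<le> M" for H :: "'a hgraph" and \<sigma>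
  proof -
    obtain H' \<sigma>' where H': "(H', \<sigma>') \<in> I" and eq: "\<And>\<epsilon> G \<kappa>. uniform_host \<epsilon> G \<kappa> \<Longrightarrow> hom_density H \<sigma> G \<kappa> = hom_density H' \<sigma>' G \<kappa>"
      using rep[OF H(1,3)] by blast
    have "vanishing H' \<sigma>'"
      unfolding vanishing_def
    proof
      fix K :: nat
      obtain \<epsilon> G \<kappa> where "0 < \<epsilon>" "\<epsilon> \<le> 1 / 2" "uniform_host \<epsilon> G \<kappa>" "hom_density H \<sigma> G \<kappa> \<le> \<epsilon> ^ K"
        using H(2) unfolding vanishing_def by blast
      thus "\<exists>\<epsilon> G \<kappa>. 0 < \<epsilon> \<and> \<epsilon> \<le> 1 / 2 \<and> uniform_host \<epsilon> G \<kappa> \<and> hom_density H' \<sigma>' G \<kappa> \<le> \<epsilon> ^ K"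
        using eq by metis
    qed
    hence "(H', \<sigma>') \<in> T" using H' by (simp add: T_def)
    thus ?thesis using G(4) eq[OF G(3)] by simp
  qed
  thus ?thesis using G by blast
qed

text \<open>Think of \<open>a\<close> as the parameter of a host with density at most \<open>a ^ K\<close> for the small graphs, and of
\<open>b = \<beta> ^ l\<close> as that of a host with density at most \<open>b powr (C + 1)\<close> for the large ones. The
product has to have density below \<open>c * (a * b) powr C\<close> for both kinds. For the large ones this
says \<open>b < c * a powr C\<close>. If \<open>l\<close> is minimal with this property, \<open>b\<close> is bounded below by a constant
times \<open>a powr C\<close>, so that a large \<open>K\<close> takes care of the small ones. That \<open>K\<close> is chosen before \<open>a\<close>
is essential, since the host with parameter \<open>a\<close> depends on \<open>K\<close>.\<close>

lemma exponent_choice: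
  fixes C c \<beta> :: real
  assumes "0 < c" "0 < \<beta>" "\<beta> \<le> 1 / 2" "0 < C"
  shows "\<exists>K. \<forall>a. 0 < a \<and> a \<le> 1 / 2 \<longrightarrow>
     (\<exists>l\<ge>1. \<beta> ^ l < c * a powr C \<and> a ^ K < c * a powr C * (\<beta> ^ l) powr C)"
proof -
  define d where "d = min 1 c"
  have d: "0 < d" "d \<le> 1" "d \<le> c" using assms by (auto simp: d_def)
  \<comment> \<open>With \<open>y = d * a powr C\<close> as below, \<open>D * a powr (C + C * C)\<close> equals \<open>d * a powr C * (\<beta> * y) powr C\<close>.\<close>
  define D where "D = d * (\<beta> * d) powr C"
  have D: "0 < D" using d assms by (simp add: D_def)
  obtain K1 where K1: "(1 / 2) ^ K1 < D" using real_arch_pow_inv[OF D, of "1 / 2"] by auto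
  obtain K2 where K2: "C + C * C \<le> real K2" using real_arch_simple by blast
  have "\<exists>l\<ge>1. \<beta> ^ l < c * a powr C \<and> a ^ (K1 + K2) < c * a powr C * (\<beta> ^ l) powr C"
    if a: "0 < a" "a \<le> 1 / 2" for a
  proof -
    define y where "y = d * a powr C"
    have "a powr C \<le> 1" using a assms by (intro powr_le1) auto
    hence y: "0 < y" "y \<le> 1" using d a mult_mono[of d 1 "a powr C" 1] by (auto simp: y_def)
    define l where "l = (LEAST l. \<beta> ^ l < y)"
    have "\<exists>l. \<beta> ^ l < y" using real_arch_pow_inv[OF y(1), of \<beta>] assms by auto
    hence l: "\<beta> ^ l < y" unfolding l_def by (rule LeastI_ex)
    have l1: "1 \<le> l"
    proof (rule ccontr)
      assume "\<not> 1 \<le> l"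
      thus False using l y by (simp add: not_le)
    qed
    have "y \<le> \<beta> ^ (l - 1)" using not_less_Least[of "l - 1" "\<lambda>l. \<beta> ^ l < y"] l1 by (simp add: l_def[symmetric])
    hence "\<beta> * y \<le> \<beta> * \<beta> ^ (l - 1)" using assms by (intro mult_left_mono) auto
    also have "\<dots> = \<beta> ^ l" using l1 by (cases l) auto
    finally have by_le: "\<beta> * y \<le> \<beta> ^ l" .
    have "a ^ (K1 + K2) = a ^ K1 * a powr real K2" using a by (simp add: power_add powr_realpow)
    also have "\<dots> \<le> (1 / 2) ^ K1 * a powr (C + C * C)"
      using a K2 by (intro mult_mono power_mono powr_mono') auto
    also have "\<dots> < D * a powr (C + C * C)"
      using K1 a by (intro mult_strict_right_mono) auto
    also have "\<dots> = d * a powr C * (\<beta> * y) powr C"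
      using a d assms by (simp add: D_def y_def powr_mult powr_powr powr_add)
    also have "\<dots> \<le> c * a powr C * (\<beta> ^ l) powr C"
      using d by_le y a assms by (intro mult_mono powr_mono2) auto
    finally have "a ^ (K1 + K2) < c * a powr C * (\<beta> ^ l) powr C" .
    moreover have "y \<le> c * a powr C" using d by (simp add: y_def mult_right_mono)
    ultimately show ?thesis using l l1 by (intro exI[of _ l]) auto
  qed
  thus ?thesis by blast
qed

text \<open>The host is a product of three: one in which the small vanishing coloured graphs have tiny
density, a power of a determined host, which is sparse for the large ones, and a polynomial host
that provides arbitrarily many vertices at the price of a constant factor \<open>k\<close> in the parameter.
The order of the quantifiers matters: \<open>\<epsilon>\<close> does not depend on the number of vertices.\<close>

lemma sparse_host:
  fixes c C :: real and N M :: nat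
  assumes "0 < c" "0 < C" "2 * (C + 1) \<le> real (N + 1)"
  shows "\<exists>\<epsilon>. 0 < \<epsilon> \<and> \<epsilon> \<le> 1 \<and> (\<forall>n\<^sub>0. \<exists>G \<kappa>. uniform_host \<epsilon> G \<kappa> \<and> n\<^sub>0 \<le> nverts G \<and>
     (\<forall>(H :: 'a hgraph) \<sigma>. coloured r F (H, \<sigma>) \<and>
        (vanishing H \<sigma> \<and> nverts (del_isolated H) \<le> M \<or> r * N < nverts (del_isolated H)) \<longrightarrow>
        hom_density H \<sigma> G \<kappa> < c * \<epsilon> powr C))"
proof -
  define k where "k = 1 / real (nverts F) ^ (r - 1)"
  have k: "0 < k" "k \<le> 1" using nverts_F_pos by (auto simp: k_def)
  define c1 where "c1 = c * k powr C"
  have c1: "0 < c1" using assms k by (simp add: c1_def)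
  obtain m G0 \<kappa>0 where m: "2 \<le> m" and G0: "uniform_host (1 / real m ^ 2) G0 \<kappa>0"
    "\<And>a. a \<in> verts F \<Longrightarrow> card (part G0 \<kappa>0 a) = m" "determined G0 \<kappa>0"
    using sparse_rs_graph by blast
  define \<beta> where "\<beta> = 1 / real m ^ 2"
  have "2 ^ 2 \<le> real m ^ 2" using m by (intro power_mono) auto
  hence \<beta>: "0 < \<beta>" "\<beta> \<le> 1 / 2" using m by (auto simp: \<beta>_def field_simps)
  obtain K where K: "\<And>a. 0 < a \<Longrightarrow> a \<le> 1 / 2 \<Longrightarrow>
      \<exists>l\<ge>1. \<beta> ^ l < c1 * a powr C \<and> a ^ K < c1 * a powr C * (\<beta> ^ l) powr C"
    using exponent_choice[OF c1 \<beta> assms(2)] by blast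
  obtain a G1 \<kappa>1 where a: "0 < a" "a \<le> 1 / 2" and G1: "uniform_host a G1 \<kappa>1"
    and small: "\<And>(H :: 'a hgraph) \<sigma>. coloured r F (H, \<sigma>) \<Longrightarrow> vanishing H \<sigma> \<Longrightarrow> nverts (del_isolated H) \<le> M \<Longrightarrow>
        hom_density H \<sigma> G1 \<kappa>1 \<le> a ^ K"
    using vanishing_at_one_host[where ?'a = 'a, of M K] by blast
  obtain l where l: "1 \<le> l" "\<beta> ^ l < c1 * a powr C" "a ^ K < c1 * a powr C * (\<beta> ^ l) powr C"
    using K[OF a] by blast
  define b where "b = \<beta> ^ l"
  have b: "0 < b" "b \<le> 1" using \<beta> by (auto simp: b_def intro!: power_le_one)
  obtain G2 \<kappa>2 where G2: "uniform_host b G2 \<kappa>2"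
    and d2: "\<And>(H :: 'a hgraph) \<sigma>. rgraph r H \<Longrightarrow> hom_density H \<sigma> G2 \<kappa>2 = hom_density H \<sigma> G0 \<kappa>0 ^ l"
    using uniform_host_power[OF G0(1) _ l(1), where ?'a = 'a] unfolding b_def \<beta>_def by auto
  let ?Q = "fprod G1 \<kappa>1 G2 \<kappa>2"
  have Q: "uniform_host (a * b) ?Q (\<kappa>1 \<circ> proj1)" using uniform_host_fprod[OF G1 G2] a b by simp
  define \<epsilon> where "\<epsilon> = a * b * k"
  have \<epsilon>: "0 < \<epsilon>" "\<epsilon> \<le> 1"
    using a b k mult_mono[of a 1 b 1] mult_mono[of "a * b" 1 k 1] by (auto simp: \<epsilon>_def)
  have ce: "c * \<epsilon> powr C = c1 * a powr C * b powr C"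
    using a b k by (simp add: \<epsilon>_def c1_def powr_mult)
  have fin0: "finite (verts G0)" "finite (verts G1)" "finite (verts G2)"
    using G0 G1 G2 by (auto simp: uniform_host_def coloured_def rgraph_def)
  have main: "\<exists>G \<kappa>. uniform_host \<epsilon> G \<kappa> \<and> n0 \<le> nverts G \<and>
     (\<forall>(H :: 'a hgraph) \<sigma>. coloured r F (H, \<sigma>) \<and>
        (vanishing H \<sigma> \<and> nverts (del_isolated H) \<le> M \<or> r * N < nverts (del_isolated H)) \<longrightarrow>
        hom_density H \<sigma> G \<kappa> < c * \<epsilon> powr C)" for n0
  proof -
    obtain G3 \<kappa>3 where G3: "uniform_host k G3 \<kappa>3" "\<And>a. a \<in> verts F \<Longrightarrow> n0 \<le> card (part G3 \<kappa>3 a)"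
      using dense_rs_graph unfolding k_def by blast
    let ?G = "fprod ?Q (\<kappa>1 \<circ> proj1) G3 \<kappa>3" and ?\<kappa> = "\<kappa>1 \<circ> proj1 \<circ> proj1"
    have G: "uniform_host \<epsilon> ?G ?\<kappa>" using uniform_host_fprod[OF Q G3(1)] a b k by (simp add: \<epsilon>_def)
    have finG: "finite (verts ?G)" and finG3: "finite (verts G3)"
      using G G3 by (auto simp: uniform_host_def coloured_def rgraph_def)
    obtain x where x: "x \<in> verts F" using nverts_F_pos by fastforce
    have "card (part ?Q (\<kappa>1 \<circ> proj1) x) \<noteq> 0"
      using Q x fin0 by (auto simp: uniform_host_def coloured_def rgraph_def)
    hence "n0 \<le> card (part ?G ?\<kappa> x)"
      using G3(2)[OF x] unfolding card_part_fprod by (simp add: card_part_fprod order_trans)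
    also have "\<dots> \<le> nverts ?G" by (rule card_part_le[OF finG])
    finally have n: "n0 \<le> nverts ?G" .
    have "hom_density H \<sigma> ?G ?\<kappa> < c * \<epsilon> powr C"
      if H: "coloured r F (H, \<sigma>)" and
        or: "vanishing H \<sigma> \<and> nverts (del_isolated H) \<le> M \<or> r * N < nverts (del_isolated H)"
      for H :: "'a hgraph" and \<sigma>
    proof -
      have rH: "rgraph r H" using H by (simp add: coloured_def)
      have eH: "e \<subseteq> verts H" if "e \<in> edges H" for e using rH that by (auto simp: rgraph_def)
      note le1 = hom_density_le_1[OF finite_verts[OF rH]] and nn = hom_density_nonneg[of H]
      have eq: "hom_density H \<sigma> ?G ?\<kappa> = hom_density H \<sigma> G1 \<kappa>1 * hom_density H \<sigma> G2 \<kappa>2 * hom_density H \<sigma> G3 \<kappa>3"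
        using eH by (simp add: hom_density_fprod)
      also have "\<dots> \<le> hom_density H \<sigma> G1 \<kappa>1 * hom_density H \<sigma> G2 \<kappa>2 * 1"
        by (intro mult_left_mono le1 finG3 mult_nonneg_nonneg nn)
      finally have le: "hom_density H \<sigma> ?G ?\<kappa> \<le> hom_density H \<sigma> G1 \<kappa>1 * hom_density H \<sigma> G2 \<kappa>2" by simp
      from or show ?thesis
      proof
        assume "vanishing H \<sigma> \<and> nverts (del_isolated H) \<le> M"
        hence "hom_density H \<sigma> G1 \<kappa>1 \<le> a ^ K" using small[OF H] by blast
        hence "hom_density H \<sigma> G1 \<kappa>1 * hom_density H \<sigma> G2 \<kappa>2 \<le> a ^ K * 1"
          using a by (intro mult_mono le1 fin0 nn) auto
        thus ?thesis using le l(3) unfolding ce b_def by linarith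
      next
        assume long: "r * N < nverts (del_isolated H)"
        have "hom_density H \<sigma> G0 \<kappa>0 \<le> 1 / real m ^ (N + 1)"
          using hom_density_le_if_determined[OF _ G0(2) _ G0(3) H long] G0(1) m by (auto simp: uniform_host_def)
        also have "\<dots> = real m powr (- real (N + 1))"
        proof -
          have "real m powr real (N + 1) = real m ^ (N + 1)" using m by (intro powr_realpow) auto
          thus ?thesis by (simp only: powr_minus inverse_eq_divide)
        qed
        also have "\<dots> \<le> real m powr (- 2 * (C + 1))"
          using m assms(3) by (intro powr_mono) auto
        also have "\<dots> = (real m powr (- 2)) powr (C + 1)" by (simp add: powr_powr)
        also have "real m powr (- 2) = \<beta>"
          using m by (simp add: \<beta>_def powr_minus powr_numeral field_simps)
        finally have "hom_density H \<sigma> G2 \<kappa>2 \<le> (\<beta> powr (C + 1)) ^ l"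
          unfolding d2[OF rH] using nn by (intro power_mono) auto
        also have "\<dots> = b powr (C + 1)"
          using \<beta> by (simp add: b_def powr_powr powr_realpow[symmetric] mult.commute)
        also have "\<dots> = b * b powr C" using b by (simp add: powr_add)
        also have "\<dots> < c1 * a powr C * b powr C"
          using l(2) b(1) unfolding b_def[symmetric] by (intro mult_strict_right_mono) auto
        finally have "hom_density H \<sigma> G2 \<kappa>2 < c * \<epsilon> powr C" by (simp add: ce)
        moreover have "hom_density H \<sigma> G1 \<kappa>1 * hom_density H \<sigma> G2 \<kappa>2 \<le> 1 * hom_density H \<sigma> G2 \<kappa>2"
          by (intro mult_right_mono le1 fin0 nn)
        ultimately show ?thesis using le by linarith
      qed
    qed
    thus ?thesis using G n by blast
  qed
  show ?thesis using \<epsilon> main by blast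
qed

section \<open>From far to uniformly far\<close>

text \<open>Deleting all edges of a maximal edge-disjoint collection of copies of \<open>F\<close> destroys every copy.\<close>

lemma exists_maximal_packing:
  fixes G :: "'b hgraph"
  assumes G: "rgraph r G" and far: "far r F \<epsilon> G"
  shows "\<exists>\<C> \<subseteq> Embs F G.
       (\<forall>\<psi>\<in>\<C>. \<forall>\<psi>'\<in>\<C>. \<psi> \<noteq> \<psi>' \<longrightarrow> ((`) \<psi> ` edges F) \<inter> ((`) \<psi>' ` edges F) = {}) \<and>
       \<epsilon> * real (nverts G) ^ r \<le> real (card \<C>) * real (nedges F)"
proof -
  define disj where "disj \<C> \<longleftrightarrow>
    (\<forall>\<psi>\<in>\<C>. \<forall>\<psi>'\<in>\<C>. \<psi> \<noteq> \<psi>' \<longrightarrow> ((`) \<psi> ` edges F) \<inter> ((`) \<psi>' ` edges F) = {})" for \<C> :: "('f \<Rightarrow> 'b) set"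
  have finE: "finite (Embs F G)" by (intro finite_Embs finite_verts_F finite_verts[OF G])
  have "\<exists>\<C>\<in>{\<C> \<in> Pow (Embs F G). disj \<C>}. \<forall>\<D>\<in>{\<C> \<in> Pow (Embs F G). disj \<C>}. \<C> \<subseteq> \<D> \<longrightarrow> \<C> = \<D>"
    by (rule finite_has_maximal) (use finE in \<open>auto simp: disj_def\<close>)
  then obtain \<C> where C: "\<C> \<subseteq> Embs F G" "disj \<C>"
    and max: "\<And>\<D>. \<D> \<subseteq> Embs F G \<Longrightarrow> disj \<D> \<Longrightarrow> \<C> \<subseteq> \<D> \<Longrightarrow> \<C> = \<D>" by auto
  have finC: "finite \<C>" by (rule finite_subset[OF C(1) finE])
  define D where "D = (\<Union>\<psi>\<in>\<C>. (`) \<psi> ` edges F)"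
  have "D \<subseteq> edges G" using C by (auto simp: D_def Embs_def embedding_def homomorphism_def)
  moreover have "free_of F (del_edges G D)"
    unfolding free_of_def
  proof
    assume "\<exists>\<phi>. embedding F (del_edges G D) \<phi>"
    then obtain \<phi> where \<phi>: "embedding F (del_edges G D) \<phi>" by blast
    define \<psi> where "\<psi> = restrict \<phi> (verts F)"
    have im: "\<psi> ` e = \<phi> ` e" if "e \<in> edges F" for e
      unfolding \<psi>_def using edge_F(1)[OF that] by (intro image_cong) auto
    have edge: "\<psi> ` e \<in> edges G" "\<psi> ` e \<notin> D" if "e \<in> edges F" for e
      using \<phi> that by (auto simp: im embedding_def homomorphism_def del_edges_def)
    have "\<psi> \<in> Embs F G"
      using \<phi> edge(1) by (auto simp: Embs_def embedding_def homomorphism_def del_edges_def \<psi>_def inj_on_def)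
    moreover have "disj (insert \<psi> \<C>)"
    proof -
      have 1: "((`) \<psi> ` edges F) \<inter> ((`) \<theta> ` edges F) = {}" if "\<theta> \<in> \<C>" for \<theta>
        using edge(2) that by (fastforce simp: D_def)
      thus ?thesis using C(2) by (auto simp: disj_def Int_commute)
    qed
    ultimately have "\<psi> \<in> \<C>" using max[of "insert \<psi> \<C>"] C by blast
    moreover obtain e where "e \<in> edges F" using edges_F by blast
    ultimately show False using edge(2)[of e] by (auto simp: D_def)
  qed
  ultimately have "\<epsilon> * real (nverts G) ^ r \<le> real (card D)" using far by (simp add: far_def)
  also have "card D \<le> (\<Sum>\<psi>\<in>\<C>. card ((`) \<psi> ` edges F))"
    unfolding D_def by (rule card_UN_le[OF finC])
  also have "\<dots> \<le> (\<Sum>\<psi>\<in>\<C>. nedges F)" by (intro sum_mono card_image_le) simp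
  finally have "\<epsilon> * real (nverts G) ^ r \<le> real (card \<C>) * real (nedges F)" by simp
  thus ?thesis using C unfolding disj_def by blast
qed

text \<open>A uniformly random map to the vertices of \<open>F\<close> colours a given copy correctly with probability
\<open>v(F)\<close> to the power \<open>-v(F)\<close>, so some map does so for at least this proportion of the copies.\<close>

lemma exists_colouring_of_many_copies:
  assumes G: "finite (verts G)" and C: "\<C> \<subseteq> Embs F G"
  shows "\<exists>\<kappa>\<in>verts G \<rightarrow> verts F.
    card \<C> \<le> card {\<psi> \<in> \<C>. \<forall>a\<in>verts F. \<kappa> (\<psi> a) = a} * nverts F ^ nverts F"
proof (rule ccontr)
  assume neg: "\<not> ?thesis"
  let ?f = "nverts F" and ?n = "nverts G"
  define K where "K = verts G \<rightarrow>\<^sub>E verts F"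
  let ?can = "\<lambda>\<kappa> \<psi>. \<forall>a\<in>verts F. \<kappa> (\<psi> a) = a"
  have finK: "finite K" using G by (auto simp: K_def intro!: finite_PiE)
  have finC: "finite \<C>" using finite_subset[OF C finite_Embs[OF finite_verts_F G]] .
  have cardK: "card K = ?f ^ ?n" using G by (simp add: K_def card_PiE)
  have many: "?f ^ ?n \<le> card {\<kappa> \<in> K. ?can \<kappa> \<psi>} * ?f ^ ?f" if "\<psi> \<in> \<C>" for \<psi>
  proof -
    have \<psi>: "inj_on \<psi> (verts F)" "\<psi> ` verts F \<subseteq> verts G"
      using that C by (auto simp: Embs_def embedding_def homomorphism_def)
    \<comment> \<open>The maps that colour the copy \<open>\<psi>\<close> correctly are free outside of its vertices.\<close>
    define T where "T x = (if x \<in> \<psi> ` verts F then {inv_into (verts F) \<psi> x} else verts F)" for x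
    have "(\<Pi>\<^sub>E x\<in>verts G. T x) \<subseteq> {\<kappa> \<in> K. ?can \<kappa> \<psi>}"
    proof
      fix \<kappa> assume k: "\<kappa> \<in> (\<Pi>\<^sub>E x\<in>verts G. T x)"
      have "T x \<subseteq> verts F" for x by (auto simp: T_def inv_into_into)
      hence "\<kappa> \<in> K" using k by (auto simp: K_def PiE_def Pi_def)
      moreover have "\<kappa> (\<psi> a) = a" if "a \<in> verts F" for a
      proof -
        have "\<kappa> (\<psi> a) \<in> T (\<psi> a)" using k \<psi>(2) that by (auto simp: PiE_def Pi_def)
        thus ?thesis using \<psi>(1) that by (simp add: T_def)
      qed
      ultimately show "\<kappa> \<in> {\<kappa> \<in> K. ?can \<kappa> \<psi>}" by simp
    qed
    hence "card (\<Pi>\<^sub>E x\<in>verts G. T x) \<le> card {\<kappa> \<in> K. ?can \<kappa> \<psi>}"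
      using finK by (intro card_mono) auto
    moreover have "card (\<Pi>\<^sub>E x\<in>verts G. T x) = ?f ^ (?n - ?f)"
    proof -
      have "card (\<Pi>\<^sub>E x\<in>verts G. T x) = (\<Prod>x\<in>verts G. card (T x))" using G by (simp add: card_PiE)
      also have "\<dots> = (\<Prod>x\<in>verts G - \<psi> ` verts F. card (T x)) * (\<Prod>x\<in>\<psi> ` verts F. card (T x))"
        by (rule prod.subset_diff[OF \<psi>(2) G])
      also have "(\<Prod>x\<in>\<psi> ` verts F. card (T x)) = 1" by (intro prod.neutral) (simp add: T_def)
      also have "(\<Prod>x\<in>verts G - \<psi> ` verts F. card (T x)) = (\<Prod>x\<in>verts G - \<psi> ` verts F. ?f)"
        by (intro prod.cong) (auto simp: T_def)
      finally show ?thesis using \<psi> by (simp add: card_Diff_subset card_image)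
    qed
    moreover have "?f \<le> ?n" using card_inj_on_le[OF \<psi> G] .
    hence "?f ^ ?n = ?f ^ (?n - ?f) * ?f ^ ?f" by (simp flip: power_add)
    ultimately show ?thesis by simp
  qed
  have "(\<Sum>\<kappa>\<in>K. card {\<psi> \<in> \<C>. ?can \<kappa> \<psi>}) = (\<Sum>\<kappa>\<in>K. \<Sum>\<psi>\<in>\<C>. if ?can \<kappa> \<psi> then 1 else 0)"
    using finC by (simp add: sum.If_cases Int_def)
  also have "\<dots> = (\<Sum>\<psi>\<in>\<C>. \<Sum>\<kappa>\<in>K. if ?can \<kappa> \<psi> then 1 else 0)" by (rule sum.swap)
  also have "\<dots> = (\<Sum>\<psi>\<in>\<C>. card {\<kappa> \<in> K. ?can \<kappa> \<psi>})"
    using finK by (simp add: sum.If_cases Int_def)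
  finally have swap: "(\<Sum>\<kappa>\<in>K. card {\<psi> \<in> \<C>. ?can \<kappa> \<psi>}) = (\<Sum>\<psi>\<in>\<C>. card {\<kappa> \<in> K. ?can \<kappa> \<psi>})" .
  have "card \<C> * ?f ^ ?n = (\<Sum>\<psi>\<in>\<C>. ?f ^ ?n)" by simp
  also have "\<dots> \<le> (\<Sum>\<psi>\<in>\<C>. card {\<kappa> \<in> K. ?can \<kappa> \<psi>} * ?f ^ ?f)" by (intro sum_mono many)
  also have "\<dots> = (\<Sum>\<kappa>\<in>K. card {\<psi> \<in> \<C>. ?can \<kappa> \<psi>} * ?f ^ ?f)"
    by (simp add: swap flip: sum_distrib_right)
  also have "\<dots> < (\<Sum>\<kappa>\<in>K. card \<C>)"
  proof (rule sum_strict_mono[OF finK])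
    show "K \<noteq> {}" using nverts_F_pos by (auto simp: K_def PiE_eq_empty_iff)
    fix \<kappa> assume "\<kappa> \<in> K"
    hence "\<kappa> \<in> verts G \<rightarrow> verts F" by (auto simp: K_def)
    thus "card {\<psi> \<in> \<C>. ?can \<kappa> \<psi>} * ?f ^ ?f < card \<C>" using neg by (meson not_le)
  qed
  also have "\<dots> = card \<C> * ?f ^ ?n" by (simp add: cardK)
  finally show False by simp
qed

text \<open>Vertices that lie on few copies have to be removed. Instead of removing them one by one, choose
a vertex set \<open>U\<close> maximising the number of copies inside \<open>U\<close> minus a multiple of the size of \<open>U\<close>:
removing any single vertex from it does not increase this potential, which is the required
lower bound on the degrees. The potential of \<open>U\<close> is at least that of the whole vertex set, which
forces many copies inside \<open>U\<close> and hence a large \<open>U\<close>.\<close>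

lemma far_imp_uniformly_far_subgraph:
  fixes G :: "'b hgraph"
  assumes G: "rgraph r G" and far: "far r F \<epsilon> G" and "0 < \<epsilon>"
    and \<delta>: "\<delta> = \<epsilon> / (2 * real (nedges F) * real (nverts F) ^ nverts F)"
  shows "\<exists>G' \<kappa>. coloured r F (G', \<kappa>) \<and> uniformly_far r F \<delta> (G', \<kappa>) \<and>
     verts G' \<subseteq> verts G \<and> edges G' \<subseteq> edges G \<and> \<delta> * real (nverts G) \<le> real (nverts G')"
proof -
  have finG: "finite (verts G)" by (rule finite_verts[OF G])
  let ?n = "real (nverts G)"
  have pos: "0 < real (nedges F)" "0 < real (nverts F)"
    using edges_F nverts_F_pos by (auto simp: card_gt_0_iff)
  have \<delta>0: "0 < \<delta>" using pos \<open>0 < \<epsilon>\<close> by (simp add: \<delta>)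
  obtain \<C> where C: "\<C> \<subseteq> Embs F G"
    "\<forall>\<psi>\<in>\<C>. \<forall>\<psi>'\<in>\<C>. \<psi> \<noteq> \<psi>' \<longrightarrow> ((`) \<psi> ` edges F) \<inter> ((`) \<psi>' ` edges F) = {}"
    and size: "\<epsilon> * ?n ^ r \<le> real (card \<C>) * real (nedges F)"
    using exists_maximal_packing[OF G far] by blast
  obtain \<kappa> where \<kappa>: "\<kappa> \<in> verts G \<rightarrow> verts F"
    and many: "card \<C> \<le> card {\<psi> \<in> \<C>. \<forall>a\<in>verts F. \<kappa> (\<psi> a) = a} * nverts F ^ nverts F"
    using exists_colouring_of_many_copies[OF finG C(1)] by blast
  define \<D> where "\<D> = {\<psi> \<in> \<C>. \<forall>a\<in>verts F. \<kappa> (\<psi> a) = a}"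
  have finC: "finite \<C>" using finite_subset[OF C(1) finite_Embs[OF finite_verts_F finG]] .
  have finD: "finite \<D>" using finC by (simp add: \<D>_def)
  have "real (card \<C>) \<le> real (card \<D>) * real (nverts F) ^ nverts F"
    using many unfolding \<D>_def[symmetric] by (metis of_nat_mono of_nat_mult of_nat_power)
  hence "real (card \<C>) * real (nedges F) \<le> real (card \<D>) * real (nverts F) ^ nverts F * real (nedges F)"
    by (intro mult_right_mono) auto
  hence "\<epsilon> * ?n ^ r \<le> real (card \<D>) * real (nverts F) ^ nverts F * real (nedges F)"
    using size by linarith
  hence sizeD: "2 * \<delta> * ?n ^ r \<le> real (card \<D>)"
    using pos by (simp add: \<delta> field_simps)
  define g where "g U = real (card {\<psi> \<in> \<D>. \<psi> ` verts F \<subseteq> U}) - \<delta> * ?n ^ (r - 1) * real (card U)" for U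
  have "Max (g ` Pow (verts G)) \<in> g ` Pow (verts G)" using finG by (intro Max_in) auto
  then obtain U where U: "U \<subseteq> verts G" "g U = Max (g ` Pow (verts G))" by auto
  have gmax: "g U' \<le> g U" if "U' \<subseteq> verts G" for U'
    unfolding U(2) using finG that by (intro Max_ge) auto
  have finU: "finite U" by (rule finite_subset[OF U(1) finG])
  define \<C>' where "\<C>' = {\<psi> \<in> \<D>. \<psi> ` verts F \<subseteq> U}"
  define G' where "G' = \<lparr>verts = U, edges = {e \<in> edges G. e \<subseteq> U \<and> \<kappa> ` e \<in> edges F}\<rparr>"
  have [simp]: "verts G' = U" by (simp add: G'_def)
  have col: "coloured r F (G', \<kappa>)"
    using G \<kappa> U(1) finU by (auto simp: coloured_def rgraph_def homomorphism_def G'_def)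
  have emb: "\<psi> \<in> Embs F G'" if "\<psi> \<in> \<C>'" for \<psi>
  proof -
    have \<psi>: "\<psi> \<in> Embs F G" "\<psi> ` verts F \<subseteq> U" "\<And>a. a \<in> verts F \<Longrightarrow> \<kappa> (\<psi> a) = a"
      using that C by (auto simp: \<C>'_def \<D>_def)
    have "\<psi> ` e \<in> edges G'" if e: "e \<in> edges F" for e
    proof -
      have "\<kappa> ` \<psi> ` e = e" using \<psi>(3) edge_F(1)[OF e] by (auto simp: image_image subset_iff)
      moreover have "\<psi> ` e \<subseteq> U" using \<psi>(2) edge_F(1)[OF e] by blast
      ultimately show ?thesis using \<psi>(1) e by (auto simp: G'_def Embs_def embedding_def homomorphism_def)
    qed
    thus ?thesis using \<psi> by (auto simp: Embs_def embedding_def homomorphism_def)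
  qed
  have pack: "packing F G' \<kappa> \<C>'"
    using C(2) emb by (auto simp: packing_def \<C>'_def \<D>_def)
  have deg: "\<delta> * ?n ^ (r - 1) \<le> real (card {\<psi> \<in> \<C>'. x \<in> \<psi> ` verts F})" if x: "x \<in> U" for x
  proof -
    let ?A = "{\<psi> \<in> \<D>. \<psi> ` verts F \<subseteq> U - {x}}" and ?B = "{\<psi> \<in> \<C>'. x \<in> \<psi> ` verts F}"
    have un: "\<C>' = ?A \<union> ?B" by (auto simp: \<C>'_def)
    have "card (?A \<union> ?B) = card ?A + card ?B"
      by (rule card_Un_disjoint) (use finD in \<open>auto simp: \<C>'_def\<close>)
    hence "card \<C>' = card ?A + card ?B" using un by simp
    moreover have "g (U - {x}) \<le> g U" using U(1) by (intro gmax) auto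
    moreover have "real (card U) = real (card (U - {x})) + 1"
      using card_Suc_Diff1[OF finU x] by linarith
    ultimately show ?thesis by (simp add: g_def \<C>'_def[symmetric] algebra_simps)
  qed
  have le_n: "card U \<le> nverts G" using card_mono[OF finG U(1)] .
  have "uniformly_far r F \<delta> (G', \<kappa>)"
    unfolding uniformly_far_iff
  proof (intro exI conjI ballI)
    show "packing F G' \<kappa> \<C>'" by (rule pack)
    fix x assume "x \<in> verts G'"
    have "\<delta> * real (nverts G') ^ (r - 1) \<le> \<delta> * ?n ^ (r - 1)"
      using le_n \<delta>0 by (intro mult_left_mono power_mono) auto
    also have "\<dots> \<le> real (card {\<psi> \<in> \<C>'. x \<in> \<psi> ` verts F})" using deg \<open>x \<in> verts G'\<close> by simp
    finally show "\<delta> * real (nverts G') ^ (r - 1) \<le> real (card {\<psi> \<in> \<C>'. x \<in> \<psi> ` verts F})" .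
  qed
  moreover have "\<delta> * ?n \<le> real (nverts G')"
  proof (cases "nverts G = 0")
    case False
    have nr: "?n ^ r = ?n * ?n ^ (r - 1)" using r_ge_2 by (simp add: power_eq_if)
    have "\<D> = {\<psi> \<in> \<D>. \<psi> ` verts F \<subseteq> verts G}"
      using C(1) by (auto simp: \<D>_def Embs_def embedding_def homomorphism_def)
    hence "g (verts G) = real (card \<D>) - \<delta> * ?n ^ r" by (simp add: g_def nr mult_ac)
    hence "\<delta> * ?n ^ r \<le> g (verts G)" using sizeD by simp
    also have "\<dots> \<le> g U" by (rule gmax) simp
    also have "\<dots> \<le> real (card \<C>')" using \<delta>0 by (simp add: g_def \<C>'_def)
    also have "\<dots> \<le> real (card U * nverts G ^ (r - 1))"
    proof -
      obtain a where a: "a \<in> verts F" using pos by fastforce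
      have "card \<C>' \<le> card (part G' \<kappa> a) * nverts G' ^ (r - 1)"
        by (rule packing_size_le[OF pack _ a]) (simp add: finU)
      also have "\<dots> \<le> card U * nverts G ^ (r - 1)"
        using card_part_le[of G' \<kappa> a] finU le_n by (intro mult_mono power_mono) auto
      finally show ?thesis by (rule of_nat_mono)
    qed
    finally have "(\<delta> * ?n) * ?n ^ (r - 1) \<le> real (card U) * ?n ^ (r - 1)"
      by (simp add: nr mult.assoc)
    thus ?thesis using False by (simp add: mult_le_cancel_right)
  qed auto
  ultimately show ?thesis using col U(1) by (intro exI[of _ G'] exI[of _ \<kappa>]) (auto simp: G'_def)
qed

text \<open>The subgraph found in a far graph is smaller by a factor that is linear in \<open>\<epsilon>\<close>, which
raises the exponent in the lower bound by the number of vertices of \<open>H\<close>.\<close>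

lemma abundant_if_abundant_col:
  assumes H: "coloured r F (H, \<sigma>)" and ab: "abundant_col r F (H, \<sigma>)"
  shows "abundant r F H"
proof -
  let ?v = "nverts H"
  define q where "q = 1 / (2 * real (nedges F) * real (nverts F) ^ nverts F)"
  have pos: "1 \<le> nedges F" "1 \<le> nverts F"
    using edges_F nverts_F_pos by (auto simp: card_gt_0_iff Suc_le_eq)
  have "1 * 1 \<le> 2 * real (nedges F) * real (nverts F) ^ nverts F"
    using pos by (intro mult_mono one_le_power) auto
  hence q: "0 < q" "q \<le> 1" by (auto simp: q_def divide_le_eq_1)
  obtain c' C' where c': "0 < c'" "0 < C'" and
    lower: "\<And>\<epsilon>::real. 0 < \<epsilon> \<Longrightarrow> \<epsilon> \<le> 1 \<Longrightarrow> \<exists>n\<^sub>0::nat. \<forall>(G::nat hgraph) \<kappa>.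
           coloured r F (G, \<kappa>) \<and> nverts G \<ge> n\<^sub>0 \<and> uniformly_far r F \<epsilon> (G, \<kappa>) \<longrightarrow>
           real (Emb_col (H, \<sigma>) (G, \<kappa>)) \<ge> c' * \<epsilon> powr C' * real (nverts G) ^ ?v"
    using ab unfolding abundant_col_def by auto
  define C'' where "C'' = C' + real ?v"
  show ?thesis
    unfolding abundant_def
  proof (rule exI[of _ "c' * q powr C''"], intro exI[of _ C''] conjI allI impI)
    show "c' * q powr C'' > 0" "C'' > 0" using c' q by (auto simp: C''_def)
    fix \<epsilon> :: real assume \<epsilon>: "0 < \<epsilon> \<and> \<epsilon> \<le> 1"
    define \<delta> where "\<delta> = \<epsilon> * q"
    have \<delta>: "0 < \<delta>" "\<delta> \<le> 1" using \<epsilon> q mult_mono[of \<epsilon> 1 q 1] by (auto simp: \<delta>_def)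
    obtain n0 :: nat where n0: "\<And>(G::nat hgraph) \<kappa>.
           coloured r F (G, \<kappa>) \<Longrightarrow> nverts G \<ge> n0 \<Longrightarrow> uniformly_far r F \<delta> (G, \<kappa>) \<Longrightarrow>
           real (Emb_col (H, \<sigma>) (G, \<kappa>)) \<ge> c' * \<delta> powr C' * real (nverts G) ^ ?v"
      using lower[OF \<delta>] by blast
    obtain n1 :: nat where n1: "real n0 / \<delta> \<le> real n1" using real_arch_simple by blast
    show "\<exists>n\<^sub>0::nat. \<forall>G::nat hgraph. rgraph r G \<and> n\<^sub>0 \<le> nverts G \<and> far r F \<epsilon> G \<longrightarrow>
           c' * q powr C'' * \<epsilon> powr C'' * real (nverts G) ^ ?v \<le> real (Emb H G)"
    proof (intro exI[of _ n1] allI impI, elim conjE)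
      fix G :: "nat hgraph" assume G: "rgraph r G" "n1 \<le> nverts G" "far r F \<epsilon> G"
      obtain G' \<kappa> where G': "coloured r F (G', \<kappa>)" "uniformly_far r F \<delta> (G', \<kappa>)"
        "verts G' \<subseteq> verts G" "edges G' \<subseteq> edges G" "\<delta> * real (nverts G) \<le> real (nverts G')"
        using far_imp_uniformly_far_subgraph[OF G(1,3), of \<delta>] \<epsilon> by (auto simp: \<delta>_def q_def)
      have "real n0 \<le> \<delta> * real n1" using n1 \<delta> by (simp add: field_simps)
      also have "\<dots> \<le> \<delta> * real (nverts G)" using G(2) \<delta> by (intro mult_left_mono) auto
      finally have n: "n0 \<le> nverts G'" using G'(5) by linarith
      have "c' * q powr C'' * \<epsilon> powr C'' * real (nverts G) ^ ?v = c' * \<delta> powr C'' * real (nverts G) ^ ?v"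
        using q \<epsilon> by (simp add: \<delta>_def powr_mult)
      also have "\<dots> = c' * \<delta> powr C' * (\<delta> * real (nverts G)) ^ ?v"
        using \<delta> by (simp add: C''_def powr_add powr_realpow power_mult_distrib)
      also have "\<dots> \<le> c' * \<delta> powr C' * real (nverts G') ^ ?v"
        using G'(5) \<delta> c' by (intro mult_left_mono power_mono) auto
      also have "\<dots> \<le> real (Emb_col (H, \<sigma>) (G', \<kappa>))" by (rule n0[OF G'(1) n G'(2)])
      also have "\<dots> \<le> real (Emb H G)"
      proof -
        have "finite (Embs H G)"
          using H G(1) by (intro finite_Embs) (auto simp: coloured_def rgraph_def)
        moreover have "{\<phi> \<in> Embs H G'. \<forall>x\<in>verts H. \<kappa> (\<phi> x) = \<sigma> x} \<subseteq> Embs H G"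
          using G'(3,4) by (auto simp: Embs_def embedding_def homomorphism_def)
        ultimately show ?thesis by (auto simp: Emb_col_def Emb_def intro: card_mono)
      qed
      finally show "c' * q powr C'' * \<epsilon> powr C'' * real (nverts G) ^ ?v \<le> real (Emb H G)" .
    qed
  qed
qed

end

section \<open>Small abundant members of abundant families\<close>

theorem theorem1p5:
  fixes r :: nat and F :: "'f hgraph" and c C :: real
  assumes "r \<ge> 2"
    and "rgraph r F" and "nedges F > 0" and "\<And>a. \<not> isolated F a"
    and "c > 0" and "C > 0"
  shows
    "(\<forall>\<H> :: ('a hgraph \<times> ('a \<Rightarrow> 'f)) set.
        (\<forall>X\<in>\<H>. coloured r F X) \<and> abundant_family_col r F c C \<H> \<longrightarrow>
        (\<exists>(H, \<sigma>)\<in>\<H>. abundant_col r F (H, \<sigma>) \<and>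
            int (nverts (del_isolated H)) \<le> \<lfloor>2 * real r * (C + 1)\<rfloor>)) \<and>
     (\<forall>\<U> :: 'a hgraph set.
        (\<forall>H\<in>\<U>. rgraph r H) \<and> abundant_family r F c C \<U> \<longrightarrow>
        (\<exists>H\<in>\<U>. abundant r F H \<and>
            int (nverts (del_isolated H)) \<le> \<lfloor>2 * real r * (C + 1)\<rfloor>))"
proof -
  interpret pattern r F
    using assms by unfold_locales (auto simp: isolated_def)
  define M where "M = nat \<lfloor>2 * real r * (C + 1)\<rfloor>"
  \<comment> \<open>A graph with more than \<open>M\<close> non-isolated vertices has more than \<open>r * N\<close> of them.\<close>
  define N where "N = nat \<lfloor>2 * (C + 1)\<rfloor>"
  have M: "int k \<le> \<lfloor>2 * real r * (C + 1)\<rfloor> \<longleftrightarrow> k \<le> M" for k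
    using assms by (auto simp: M_def le_nat_iff)
  have N: "2 * (C + 1) \<le> real (N + 1)" using assms by (simp add: N_def) linarith
  have rN: "r * N < k" if "\<not> k \<le> M" for k
  proof -
    have "real N \<le> 2 * (C + 1)" using assms by (simp add: N_def)
    hence "real r * real N \<le> real r * (2 * (C + 1))" by (intro mult_left_mono) auto
    hence "real (r * N) \<le> 2 * real r * (C + 1)" by (simp add: algebra_simps)
    hence "int (r * N) \<le> \<lfloor>2 * real r * (C + 1)\<rfloor>" by (simp only: le_floor_iff of_int_of_nat_eq)
    hence "r * N \<le> M" by (simp only: M)
    thus ?thesis using that by linarith
  qed
  show ?thesis
    unfolding M
  proof (intro conjI allI impI; elim conjE)
    fix \<H> :: "('a hgraph \<times> ('a \<Rightarrow> 'f)) set"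
    assume col: "\<forall>X\<in>\<H>. coloured r F X" and ab: "abundant_family_col r F c C \<H>"
    show "\<exists>(H, \<sigma>)\<in>\<H>. abundant_col r F (H, \<sigma>) \<and> nverts (del_isolated H) \<le> M"
    proof (rule ccontr)
      assume neg: "\<not> ?thesis"
      obtain \<epsilon> where \<epsilon>: "0 < \<epsilon>" "\<epsilon> \<le> 1" and host: "\<And>n0. \<exists>G \<kappa>. uniform_host \<epsilon> G \<kappa> \<and> n0 \<le> nverts G \<and>
        (\<forall>(H :: 'a hgraph) \<sigma>. coloured r F (H, \<sigma>) \<and>
           (vanishing H \<sigma> \<and> nverts (del_isolated H) \<le> M \<or> r * N < nverts (del_isolated H)) \<longrightarrow>
           hom_density H \<sigma> G \<kappa> < c * \<epsilon> powr C)"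
        using sparse_host[OF assms(5,6) N, where ?'a = 'a, of M] by blast
      obtain n0 where n0: "\<And>(G::nat hgraph) \<kappa>.
           coloured r F (G, \<kappa>) \<Longrightarrow> nverts G \<ge> n0 \<Longrightarrow> uniformly_far r F \<epsilon> (G, \<kappa>) \<Longrightarrow>
           (\<exists>(H, \<sigma>)\<in>\<H>. real (Emb_col (H, \<sigma>) (G, \<kappa>)) \<ge> c * \<epsilon> powr C * real (nverts G) ^ nverts H)"
        using ab \<epsilon> unfolding abundant_family_col_def by blast
      obtain G \<kappa> where G: "uniform_host \<epsilon> G \<kappa>" "max n0 1 \<le> nverts G" and
        sparse: "\<And>(H :: 'a hgraph) \<sigma>. coloured r F (H, \<sigma>) \<Longrightarrow>
           vanishing H \<sigma> \<and> nverts (del_isolated H) \<le> M \<or> r * N < nverts (del_isolated H) \<Longrightarrow>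
           hom_density H \<sigma> G \<kappa> < c * \<epsilon> powr C"
        using host[of "max n0 1"] by blast
      obtain H \<sigma> where H: "(H, \<sigma>) \<in> \<H>"
        "c * \<epsilon> powr C * real (nverts G) ^ nverts H \<le> real (Emb_col (H, \<sigma>) (G, \<kappa>))"
        using n0[of G \<kappa>] G by (auto simp: uniform_host_def)
      have colH: "coloured r F (H, \<sigma>)" using H col by blast
      have "vanishing H \<sigma> \<and> nverts (del_isolated H) \<le> M \<or> r * N < nverts (del_isolated H)"
        using neg H(1) vanishing_if_not_abundant_col[OF colH] rN[of "nverts (del_isolated H)"] by blast
      hence "hom_density H \<sigma> G \<kappa> < c * \<epsilon> powr C" by (rule sparse[OF colH])
      hence "hom_density H \<sigma> G \<kappa> * real (nverts G) ^ nverts H < c * \<epsilon> powr C * real (nverts G) ^ nverts H"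
        using G(2) by (intro mult_strict_right_mono) auto
      moreover have "real (Emb_col (H, \<sigma>) (G, \<kappa>)) \<le> hom_density H \<sigma> G \<kappa> * real (nverts G) ^ nverts H"
        using colH G(1) by (intro Emb_col_le_hom_density) (auto simp: uniform_host_def coloured_def rgraph_def)
      ultimately show False using H(2) by linarith
    qed
  next
    fix \<U> :: "'a hgraph set"
    assume rg: "\<forall>H\<in>\<U>. rgraph r H" and ab: "abundant_family r F c C \<U>"
    show "\<exists>H\<in>\<U>. abundant r F H \<and> nverts (del_isolated H) \<le> M"
    proof (rule ccontr)
      assume neg: "\<not> ?thesis"
      let ?f = "real (nverts F)"
      have f: "1 \<le> ?f" using nverts_F_pos by linarith
      \<comment> \<open>The factor \<open>(1 / ?f) powr C\<close> pays for the loss from uniformly far to far, and the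
        factor \<open>1 / 2\<close> turns the bound obtained below into a strict one.\<close>
      define c' where "c' = c * (1 / ?f) powr C / 2"
      have "0 < (1 / ?f) powr C" using f by (subst powr_gt_zero) auto
      hence c': "0 < c'" using assms(5) unfolding c'_def by (intro divide_pos_pos mult_pos_pos) auto
      obtain \<epsilon> where \<epsilon>: "0 < \<epsilon>" "\<epsilon> \<le> 1" and host: "\<And>n0. \<exists>G \<kappa>. uniform_host \<epsilon> G \<kappa> \<and> n0 \<le> nverts G \<and>
        (\<forall>(H :: 'a hgraph) \<sigma>. coloured r F (H, \<sigma>) \<and>
           (vanishing H \<sigma> \<and> nverts (del_isolated H) \<le> M \<or> r * N < nverts (del_isolated H)) \<longrightarrow>
           hom_density H \<sigma> G \<kappa> < c' * \<epsilon> powr C)"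
        using sparse_host[OF c' assms(6) N, where ?'a = 'a, of M] by blast
      have "0 < \<epsilon> / ?f" "\<epsilon> / ?f \<le> 1" using \<epsilon> f by auto
      then obtain n0 where n0: "\<And>G::nat hgraph.
           rgraph r G \<Longrightarrow> nverts G \<ge> n0 \<Longrightarrow> far r F (\<epsilon> / ?f) G \<Longrightarrow>
           (\<exists>H\<in>\<U>. real (Emb H G) \<ge> c * (\<epsilon> / ?f) powr C * real (nverts G) ^ nverts H)"
        using ab unfolding abundant_family_def by blast
      obtain G \<kappa> where G: "uniform_host \<epsilon> G \<kappa>" "max n0 1 \<le> nverts G" and
        sparse: "\<And>(H :: 'a hgraph) \<sigma>. coloured r F (H, \<sigma>) \<Longrightarrow>
           vanishing H \<sigma> \<and> nverts (del_isolated H) \<le> M \<or> r * N < nverts (del_isolated H) \<Longrightarrow>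
           hom_density H \<sigma> G \<kappa> < c' * \<epsilon> powr C"
        using host[of "max n0 1"] by blast
      have colG: "coloured r F (G, \<kappa>)" using G by (simp add: uniform_host_def)
      have "far r F (\<epsilon> / ?f) G" using G colG by (intro uniformly_far_imp_far) (auto simp: uniform_host_def)
      then obtain H where H: "H \<in> \<U>"
        "c * (\<epsilon> / ?f) powr C * real (nverts G) ^ nverts H \<le> real (Emb H G)"
        using n0[of G] G colG by (auto simp: coloured_def)
      have rH: "rgraph r H" using H rg by blast
      have "real (Emb H G) \<le> c' * \<epsilon> powr C * real (nverts G) ^ nverts H"
      proof (rule Emb_le_hom_density[OF rH colG finite_verts_F])
        fix \<sigma> assume colH: "coloured r F (H, \<sigma>)"
        have "vanishing H \<sigma> \<and> nverts (del_isolated H) \<le> M \<or> r * N < nverts (del_isolated H)"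
          using neg H(1) vanishing_if_not_abundant_col[OF colH] abundant_if_abundant_col[OF colH]
            rN[of "nverts (del_isolated H)"] by blast
        thus "hom_density H \<sigma> G \<kappa> \<le> c' * \<epsilon> powr C" using sparse[OF colH] by linarith
      qed (use c' in auto)
      also have "\<dots> < 2 * c' * \<epsilon> powr C * real (nverts G) ^ nverts H"
        using c' \<epsilon> G(2) by (intro mult_strict_right_mono) auto
      also have "2 * c' * \<epsilon> powr C = c * (\<epsilon> / ?f) powr C"
        using \<epsilon> f by (simp add: c'_def powr_divide)
      finally show False using H(2) by linarith
    qed
  qed
qed

end
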